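(* For every computable perfect Polish space $X$, $$\Pi^0_1\mathsf G\equiv_{\mathrm{sW}}\mathsf{BCT}_{2,X}\equiv_{\mathrm{sW}}\mathsf{BCT}_{0,X}'.$$
   Context: Represented spaces and Weihrauch reducibility. The symbol $\subseteq$ in front of a domain means "possibly partial". A represented space $(X,\delta_X)$ is a set $X$ with a surjective partial map $\delta_X:\subseteq\mathbb N^{\mathbb N}\to X$. A multi-valued function $f:\subseteq X\rightrightarrows Y$ assigns to each $x\in\mathrm{dom}(f)$ a nonempty set $f(x)\subseteq Y$. A realizer $F\vdash f$ is a partial function $F:\subseteq\mathbb N^{\mathbb N}\to\mathbb N^{\mathbb N}$ with $\delta_YF(p)\in f(\delta_X(p))$ for all $p\in\mathrm{dom}(f\delta_X)$. $f\le_{\mathrm{sW}}g$: there are computable $K,H:\subseteq\mathbb N^{\mathbb N}\to\mathbb N^{\mathbb N}$ with $HGK\vdash f$ for all $G\vdash g$; $\equiv_{\mathrm{sW}}$ is reducibility in both directions. With $\langle p_0,p_1,\dots\rangle(\langle i,j\rangle):=p_i(j)$, the sequence space $X^{\mathbb N}$ is represented by $\delta_X^{\mathbb N}\langle p_0,p_1,\dots\rangle:=(\delta_X(p_i))_i$. Jump. $\lim:\subseteq\mathbb N^{\mathbb N}\to\mathbb N^{\mathbb N}$, $\langle p_0,p_1,\dots\rangle\mapsto\lim_np_n$ (product topology). The jump $f'$ of $f:\subseteq(X,\delta_X)\rightrightarrows(Y,\delta_Y)$ is the same multi-valued function with input representation replaced by $\delta_X\circ\lim$. A computable Polish space $(X,d,\alpha)$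 is a complete metric space with a dense sequence $\alpha:\mathbb N\to X$ such that $d\circ(\alpha\times\alpha):\mathbb N^2\to\mathbb R$ is computable; it is perfect if it has no isolated points. The Cauchy representation is $\delta_X(p)=\lim_n\alpha(p(n))$, for those $p$ with $d(\alpha p(n),\alpha p(k))<2^{-k}$ for all $k$ and $n\ge k$. $X\sqcup\{\infty\}$ is $X$ with an additional isolated point $\infty$ at distance $1$ from all other points. $\mathcal A_-(X)$ is the set of closed subsets of $X$ with representation $\psi_-(p):=X\setminus\bigcup_iB_{p(i)}$, where $B_{\langle n,k\rangle}:=B(\alpha(n),\overline k)$ and $\overline k$ is the $k$-th rational in a standard enumeration. $\mathcal A_+(X)$ is the set of closed subsets of $X$ with representation $\psi_+(p)=A$ iff $\delta^{\mathbb N}_{X\sqcup\{\infty\}}(p)=(x_n)_n$ and $\overline{\{x_n:n\in\mathbb N\}}\cap X=A$. $\mathsf{BCT}_{0,X}:\subseteq\mathcal A_-(X)^{\mathbb N}\rightrightarrows X$ and $\mathsf{BCT}_{2,X}:\subseteq\mathcal A_+(X)^{\mathbb N}\rightrightarrows X$ both map $(A_i)_i$ to $X\setminus\bigcup_iA_i$, with domain all $(A_i)_i$ such that every $A_i$ has empty interior. $\Pi^0_1$-genericity. $\{0,1\}^*$ is the (discrete) space of finite binary words; a $\psi_-$-name $p$ of a set $E\subseteq\{0,1\}^*$ is an enumeration of the complement of $E$. $\mathcal A_\#(2^{\mathbb N})$ is the set of closed subsets of $2^{\mathbb N}$ with representation $\psi_\#(p):=2^{\mathbb N}\setminus\bigcup_{w\in\psi_-(p)}w2^{\mathbb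 N}$, where $w2^{\mathbb N}$ is the set of infinite binary sequences with prefix $w$. $\Pi^0_1\mathsf G:\subseteq\mathcal A_\#(2^{\mathbb N})^{\mathbb N}\rightrightarrows2^{\mathbb N}$ maps $(A_i)_i$ to $\bigcap_i(2^{\mathbb N}\setminus A_i)$, with domain all $(A_i)_i$ such that every $A_i$ has empty interior. *)

theory Defs
  imports "HOL-Analysis.Analysis" "HOL-Library.Nat_Bijection"
begin

section \<open>Computable functions on Baire space\<close>

type_synonym baire = "nat \<Rightarrow> nat"

text \<open>
  Partial recursive functionals of an oracle, in one variable: Kleene's schemes, with the Cantor
  pairing in place of several arguments. The closure conditions do not refer to a particular
  oracle, hence every derivation is one oracle program, used uniformly for all oracles.
  In \<open>mu\<close>, the search diverges if it meets an undefined value before the first zero.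
\<close>

inductive partial_recursive :: "(baire \<Rightarrow> nat \<rightharpoonup> nat) \<Rightarrow> bool" where
  zero: "partial_recursive (\<lambda>p n. Some 0)"
| succ: "partial_recursive (\<lambda>p n. Some (Suc n))"
| left: "partial_recursive (\<lambda>p n. Some (fst (prod_decode n)))"
| right: "partial_recursive (\<lambda>p n. Some (snd (prod_decode n)))"
| oracle_query: "partial_recursive (\<lambda>p n. Some (p n))"
| pair: "partial_recursive (\<lambda>p n. Option.bind (\<Phi> p n)
           (\<lambda>a. Option.bind (\<Psi> p n) (\<lambda>b. Some (prod_encode (a, b)))))"
    if "partial_recursive \<Phi>" and "partial_recursive \<Psi>"
| comp: "partial_recursive (\<lambda>p n. Option.bind (\<Psi> p n) (\<Phi> p))"
    if "partial_recursive \<Phi>" and "partial_recursive \<Psi>"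
| prim_rec: "partial_recursive (\<lambda>p n. case prod_decode n of (a, k) \<Rightarrow>
           rec_nat (\<Phi> p a)
             (\<lambda>j r. Option.bind r (\<lambda>b. \<Psi> p (prod_encode (a, prod_encode (j, b))))) k)"
    if "partial_recursive \<Phi>" and "partial_recursive \<Psi>"
| mu: "partial_recursive (\<lambda>p n.
           if \<exists>k. \<Phi> p (prod_encode (n, k)) = Some 0 \<and> (\<forall>j<k. \<Phi> p (prod_encode (n, j)) \<noteq> None)
           then Some (LEAST k. \<Phi> p (prod_encode (n, k)) = Some 0) else None)"
    if "partial_recursive \<Phi>"

text \<open>As usual, the program may also produce output outside the domain of \<open>F\<close>.\<close>

definition computable :: "(baire \<rightharpoonup> baire) \<Rightarrow> bool" where
  "computable F \<longleftrightarrow>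
     (\<exists>\<Phi>. partial_recursive \<Phi> \<and> (\<forall>p q. F p = Some q \<longrightarrow> (\<forall>n. \<Phi> p n = Some (q n))))"

text \<open>For functions on \<open>\<nat>\<close> the program must not depend on the oracle.\<close>

definition computable_nat :: "(nat \<Rightarrow> nat) \<Rightarrow> bool" where
  "computable_nat f \<longleftrightarrow> (\<exists>\<Phi>. partial_recursive \<Phi> \<and> (\<forall>p n. \<Phi> p n = Some (f n)))"


section \<open>Represented spaces and strong Weihrauch reducibility\<close>

text \<open>
  A representation is a partial map on Baire space; the represented set is its range.
  A multi-valued function is a set-valued map, its domain being the set of points with nonempty
  value. A problem is a multi-valued function with representations of its source and target.
\<close>

type_synonym 'x representation = "baire \<rightharpoonup> 'x"
type_synonym ('x, 'y) multifun = "'x \<Rightarrow> 'y set"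

definition mv_dom :: "('x, 'y) multifun \<Rightarrow> 'x set" where
  "mv_dom f = {x. f x \<noteq> {}}"

record ('x, 'y) problem =
  in_rep :: "'x representation"
  out_rep :: "'y representation"
  multi :: "('x, 'y) multifun"

definition realizes :: "(baire \<rightharpoonup> baire) \<Rightarrow> ('x, 'y) problem \<Rightarrow> bool" (infix "\<turnstile>" 50) where
  "F \<turnstile> f \<longleftrightarrow> (\<forall>p x. in_rep f p = Some x \<and> x \<in> mv_dom (multi f) \<longrightarrow>
     (\<exists>q y. F p = Some q \<and> out_rep f q = Some y \<and> y \<in> multi f x))"

definition sW_reducible :: "('x, 'y) problem \<Rightarrow> ('u, 'v) problem \<Rightarrow> bool"
    (infix "\<le>\<^sub>s\<^sub>W" 50) where
  "f \<le>\<^sub>s\<^sub>W g \<longleftrightarrow>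
     (\<exists>K H. computable K \<and> computable H \<and> (\<forall>G. G \<turnstile> g \<longrightarrow> (H \<circ>\<^sub>m G \<circ>\<^sub>m K) \<turnstile> f))"

definition sW_equivalent :: "('x, 'y) problem \<Rightarrow> ('u, 'v) problem \<Rightarrow> bool"
    (infix "\<equiv>\<^sub>s\<^sub>W" 50) where
  "f \<equiv>\<^sub>s\<^sub>W g \<longleftrightarrow> f \<le>\<^sub>s\<^sub>W g \<and> g \<le>\<^sub>s\<^sub>W f"

definition component :: "baire \<Rightarrow> nat \<Rightarrow> baire" where
  "component p i = (\<lambda>j. p (prod_encode (i, j)))"

definition seq_rep :: "'x representation \<Rightarrow> (nat \<Rightarrow> 'x) representation" where
  "seq_rep \<delta> p =
     (if \<forall>i. component p i \<in> dom \<delta> then Some (\<lambda>i. the (\<delta> (component p i))) else None)"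

text \<open>The limit is taken in the product topology on \<open>nat \<Rightarrow> nat\<close>, with \<open>nat\<close> discrete.\<close>

definition baire_lim :: "baire \<rightharpoonup> baire" where
  "baire_lim p = (if \<exists>q. component p \<longlonglongrightarrow> q then Some (THE q. component p \<longlonglongrightarrow> q) else None)"

definition jump :: "('x, 'y) problem \<Rightarrow> ('x, 'y) problem" where
  "jump f = f\<lparr>in_rep := in_rep f \<circ>\<^sub>m baire_lim\<rparr>"


section \<open>Computable Polish spaces\<close>

definition rat_enum :: "nat \<Rightarrow> rat" where
  "rat_enum k = (case prod_decode k of (n, m) \<Rightarrow>
     case prod_decode n of (i, j) \<Rightarrow> (of_nat i - of_nat j) / of_nat (Suc m))"

text \<open>
  The Cauchy representation and its companions take the distance \<open>d\<close> as an argument, since they are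
  also used for \<open>X \<squnion> {\<infinity>}\<close>, whose distance below violates the triangle inequality if \<open>X\<close> has
  diameter greater than 2. This does no harm: fast Cauchy sequences have consecutive distances
  less than 1 and therefore lie either in \<open>X\<close> or at \<open>\<infinity>\<close>.
\<close>

definition metric_limit :: "('x \<Rightarrow> 'x \<Rightarrow> real) \<Rightarrow> (nat \<Rightarrow> 'x) \<Rightarrow> 'x \<Rightarrow> bool" where
  "metric_limit d s x \<longleftrightarrow> (\<lambda>n. d (s n) x) \<longlonglongrightarrow> 0"

definition cauchy_rep :: "('x \<Rightarrow> 'x \<Rightarrow> real) \<Rightarrow> (nat \<Rightarrow> 'x) \<Rightarrow> 'x representation" where
  "cauchy_rep d \<alpha> p =
     (if (\<forall>k n. k \<le> n \<longrightarrow> d (\<alpha> (p n)) (\<alpha> (p k)) < 1 / 2 ^ k) \<and> (\<exists>x. metric_limit d (\<alpha> \<circ> p) x)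
      then Some (THE x. metric_limit d (\<alpha> \<circ> p) x) else None)"

text \<open>
  Computability of the distance \<open>\<nat>\<^sup>2 \<rightarrow> \<real>\<close>: names of the values, in the Cauchy representation of the
  reals, can be computed from the indices.
\<close>

definition computable_polish :: "(nat \<Rightarrow> 'a::polish_space) \<Rightarrow> bool" where
  "computable_polish \<alpha> \<longleftrightarrow> closure (range \<alpha>) = UNIV \<and>
     (\<exists>r. computable_nat r \<and> (\<forall>i j.
        cauchy_rep dist (\<lambda>k. real_of_rat (rat_enum k))
          (\<lambda>k. r (prod_encode (prod_encode (i, j), k))) = Some (dist (\<alpha> i) (\<alpha> j))))"

datatype 'a adjoin_inf = Point 'a | Infty

fun dist_inf :: "'a::metric_space adjoin_inf \<Rightarrow> 'a adjoin_inf \<Rightarrow> real" where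
  "dist_inf (Point x) (Point y) = dist x y"
| "dist_inf Infty Infty = 0"
| "dist_inf (Point x) Infty = 1"
| "dist_inf Infty (Point y) = 1"

fun dense_inf :: "(nat \<Rightarrow> 'a) \<Rightarrow> nat \<Rightarrow> 'a adjoin_inf" where
  "dense_inf \<alpha> 0 = Infty"
| "dense_inf \<alpha> (Suc n) = Point (\<alpha> n)"

text \<open>
  Negative and positive information about closed sets. A ball with nonpositive radius is empty.
\<close>

definition basic_ball :: "(nat \<Rightarrow> 'a::metric_space) \<Rightarrow> nat \<Rightarrow> 'a set" where
  "basic_ball \<alpha> i =
     (case prod_decode i of (n, k) \<Rightarrow> ball (\<alpha> n) (real_of_rat (rat_enum k)))"

definition psi_minus :: "(nat \<Rightarrow> 'a::metric_space) \<Rightarrow> 'a set representation" where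
  "psi_minus \<alpha> p = Some (UNIV - (\<Union>i. basic_ball \<alpha> (p i)))"

definition metric_closure :: "('x \<Rightarrow> 'x \<Rightarrow> real) \<Rightarrow> 'x set \<Rightarrow> 'x set" where
  "metric_closure d S = {x. \<forall>e>0. \<exists>s\<in>S. d s x < e}"

definition psi_plus :: "(nat \<Rightarrow> 'a::metric_space) \<Rightarrow> 'a set representation" where
  "psi_plus \<alpha> p = map_option (\<lambda>s. {x. Point x \<in> metric_closure dist_inf (range s)})
     (seq_rep (cauchy_rep dist_inf (dense_inf \<alpha>)) p)"


section \<open>The Baire category problems\<close>

definition bct :: "(nat \<Rightarrow> 'a::topological_space set, 'a) multifun" where
  "bct A = (if \<forall>i. closed (A i) \<and> interior (A i) = {} then UNIV - (\<Union>i. A i) else {})"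

definition BCT0 :: "(nat \<Rightarrow> 'a::polish_space) \<Rightarrow> (nat \<Rightarrow> 'a set, 'a) problem" where
  "BCT0 \<alpha> = \<lparr>in_rep = seq_rep (psi_minus \<alpha>), out_rep = cauchy_rep dist \<alpha>, multi = bct\<rparr>"

definition BCT2 :: "(nat \<Rightarrow> 'a::polish_space) \<Rightarrow> (nat \<Rightarrow> 'a set, 'a) problem" where
  "BCT2 \<alpha> = \<lparr>in_rep = seq_rep (psi_plus \<alpha>), out_rep = cauchy_rep dist \<alpha>, multi = bct\<rparr>"


section \<open>Genericity\<close>

text \<open>Bijective base-2 numeration, a bijection between binary words and natural numbers.\<close>

fun word_code :: "bool list \<Rightarrow> nat" where
  "word_code [] = 0"
| "word_code (b # w) = 2 * word_code w + (if b then 2 else 1)"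

text \<open>
  The set named by \<open>p\<close>: its complement is enumerated by \<open>p\<close>, where the value 0 enumerates nothing
  (so that the complement may be empty).
\<close>

definition psi_minus_words :: "baire \<Rightarrow> bool list set" where
  "psi_minus_words p = UNIV - {w. \<exists>i. p i = Suc (word_code w)}"

definition cylinder :: "bool list \<Rightarrow> (nat \<Rightarrow> bool) set" where
  "cylinder w = {x. \<forall>i<length w. x i = w ! i}"

definition psi_sharp :: "(nat \<Rightarrow> bool) set representation" where
  "psi_sharp p = Some (UNIV - (\<Union>w\<in>psi_minus_words p. cylinder w))"

definition cantor_rep :: "(nat \<Rightarrow> bool) representation" where
  "cantor_rep p = (if range p \<subseteq> {0, 1} then Some (\<lambda>n. p n = 1) else None)"

definition pi01_generic :: "(nat \<Rightarrow> (nat \<Rightarrow> bool) set, nat \<Rightarrow> bool) multifun" where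
  "pi01_generic A =
     (if \<forall>i. closed (A i) \<and> interior (A i) = {} then (\<Inter>i. UNIV - A i) else {})"

definition Pi01_G :: "(nat \<Rightarrow> (nat \<Rightarrow> bool) set, nat \<Rightarrow> bool) problem" where
  "Pi01_G = \<lparr>in_rep = seq_rep psi_sharp, out_rep = cantor_rep, multi = pi01_generic\<rparr>"


section \<open>The domains are as intended, by the Baire category theorem\<close>

lemma empty_interior_Union:
  fixes A :: "nat \<Rightarrow> 'a::topological_space set"
  assumes "completely_metrizable_space (euclidean :: 'a topology) \<or>
      locally_compact_space (euclidean :: 'a topology) \<and> regular_space (euclidean :: 'a topology)"
    and "\<forall>i. closed (A i) \<and> interior (A i) = {}"
  shows "UNIV - (\<Union>i. A i) \<noteq> {}"
proof -
  have "euclidean interior_of \<Union>(range A) = {}"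
    using assms by (intro Baire_category_alt) auto
  then have "\<Union>(range A) \<noteq> UNIV"
    by (metis UNIV_not_empty interior_UNIV euclidean_interior_of)
  then show ?thesis
    by blast
qed

lemma mv_dom_bct:
  "mv_dom (bct :: (nat \<Rightarrow> 'a::polish_space set, 'a) multifun) =
     {A. \<forall>i. closed (A i) \<and> interior (A i) = {}}"
  using empty_interior_Union[where 'a='a] completely_metrizable_space_euclidean
  by (auto simp: mv_dom_def bct_def)

lemma mv_dom_pi01_generic:
  "mv_dom pi01_generic = {A. \<forall>i. closed (A i) \<and> interior (A i) = {}}"
proof -
  have eq: "(euclidean :: (nat \<Rightarrow> bool) topology) = product_topology (\<lambda>_. euclidean) UNIV"
    by (simp add: euclidean_product_topology)
  have "compact_space (euclidean :: bool topology)"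
    by (simp add: compact_space_def finite_imp_compact)
  then have "compact_space (euclidean :: (nat \<Rightarrow> bool) topology)"
    unfolding eq by (simp add: compact_space_product_topology)
  moreover have "Hausdorff_space (euclidean :: bool topology)"
    unfolding Hausdorff_space_def
    by (metis disjnt_insert1 disjnt_empty1 empty_iff insert_iff open_discrete open_openin)
  then have "Hausdorff_space (euclidean :: (nat \<Rightarrow> bool) topology)"
    unfolding eq by (simp add: Hausdorff_space_product_topology)
  ultimately have "UNIV - (\<Union>i. A i) \<noteq> {}"
    if "\<forall>i. closed (A i) \<and> interior (A i) = {}" for A :: "nat \<Rightarrow> (nat \<Rightarrow> bool) set"
    using that by (intro empty_interior_Union)
      (auto intro: compact_imp_locally_compact_space compact_Hausdorff_imp_regular_space)
  then show ?thesis
    by (auto simp: mv_dom_def pi01_generic_def)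
qed

end

theory Submission
  imports Defs
begin

text \<open>
  The three problems form a cycle \<open>\<Pi>\<^sup>0\<^sub>1G \<le> BCT\<^sub>0' \<le> BCT\<^sub>2 \<le> \<Pi>\<^sup>0\<^sub>1G\<close>.

  \<open>BCT\<^sub>0' \<le> BCT\<^sub>2\<close> (\<open>jump_BCT0_le_BCT2\<close>): from a dense open set \<open>U\<close> known in the limit one can list points that
  come arbitrarily close to every point outside \<open>U\<close>, but do not accumulate in \<open>U\<close>. The
  points are listed with growing precision: a point listed late has to stay away from what currently appears to be in \<open>U\<close>, up to a small tolerance
  at the boundary. In a perfect space the closure of the listed points is nowhere dense, and it
  contains the complement of \<open>U\<close>.

  \<open>BCT\<^sub>2 \<le> \<Pi>\<^sup>0\<^sub>1G\<close> (\<open>BCT2_le_Pi01_G\<close>): binary sequences are read as programs that shrink a ball in the space. Given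
  dense sequences in the sets \<open>A\<^sub>i\<close>, the words whose ball is disjoint from \<open>A\<^sub>i\<close> form a \<open>\<Pi>\<^sup>0\<^sub>1\<close> set, in which every
  word has an extension. A generic sequence produces a point outside all \<open>A\<^sub>i\<close>.

  \<open>\<Pi>\<^sup>0\<^sub>1G \<le> BCT\<^sub>0'\<close> (\<open>Pi01_G_le_jump_BCT0\<close>): conversely, a binary sequence has to be computed from a generic point
  alone. For this the space carries a binary tree of nonempty open cells: the cells of \<open>w0\<close> and \<open>w1\<close> are
  disjoint and their union is dense in the cell of \<open>w\<close>, and every open set contains a cell. The
  branch of a point that avoids all boundaries is computable from any name of the point. A
  \<open>\<Pi>\<^sup>0\<^sub>1\<close> dense set of words yields a dense open set of points, the union of its cells, which is known in the
  limit. The cells are cut out by balls whose radii avoid all distances in the dense sequence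
  (\<open>ex_generic_radii\<close>); then it is decidable which elements of the dense sequence belong to which cell, and the
  tree can be built by searching for balls that split a cell.

  All programs are obtained from closure properties: of recursive functions, of decidable and
  semidecidable predicates, of computable real numbers with semidecidable strict order, and from the
  fact that a semidecidable relation has a partial recursive selection function.
\<close>

section \<open>Recursive functions and decidable predicates\<close>

definition recursive :: "(baire \<Rightarrow> nat \<Rightarrow> nat) \<Rightarrow> bool" where
  "recursive f \<longleftrightarrow> partial_recursive (\<lambda>p n. Some (f p n))"

abbreviation pair :: "nat \<Rightarrow> nat \<Rightarrow> nat" where
  "pair a b \<equiv> prod_encode (a, b)"

abbreviation pfst :: "nat \<Rightarrow> nat" where
  "pfst n \<equiv> fst (prod_decode n)"

abbreviation psnd :: "nat \<Rightarrow> nat" where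
  "psnd n \<equiv> snd (prod_decode n)"

text \<open>
  Resolution with these rules shows that a function is recursive by following the term that
  defines it. A function of several arguments takes them as the components of one number.
\<close>

named_theorems recursive_intros

lemma recursive_compose:
  assumes "recursive g" "recursive f"
  shows "recursive (\<lambda>p n. g p (f p n))"
  using partial_recursive.comp[OF assms[unfolded recursive_def]] by (simp add: recursive_def)

lemma recursive_Suc [recursive_intros]:
  "recursive f \<Longrightarrow> recursive (\<lambda>p n. Suc (f p n))"
  using recursive_compose[of "\<lambda>p n. Suc n" f] partial_recursive.succ by (simp add: recursive_def)

lemma recursive_const [recursive_intros]: "recursive (\<lambda>p n. c)"
  by (induction c) (auto intro: recursive_intros simp: recursive_def[of "\<lambda>p n. 0"] partial_recursive.zero)

lemma recursive_pair [recursive_intros]: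
  "recursive f \<Longrightarrow> recursive g \<Longrightarrow> recursive (\<lambda>p n. pair (f p n) (g p n))"
  using partial_recursive.pair[of "\<lambda>p n. Some (f p n)" "\<lambda>p n. Some (g p n)"]
  by (simp add: recursive_def)

lemma recursive_fst [recursive_intros]:
  "recursive f \<Longrightarrow> recursive (\<lambda>p n. pfst (f p n))"
  using recursive_compose[of "\<lambda>p n. pfst n" f] partial_recursive.left by (simp add: recursive_def)

lemma recursive_snd [recursive_intros]:
  "recursive f \<Longrightarrow> recursive (\<lambda>p n. psnd (f p n))"
  using recursive_compose[of "\<lambda>p n. psnd n" f] partial_recursive.right by (simp add: recursive_def)

lemma recursive_id [recursive_intros]: "recursive (\<lambda>p n. n)"
proof -
  have "recursive (\<lambda>p n. pfst n)" "recursive (\<lambda>p n. psnd n)"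
    using partial_recursive.left partial_recursive.right by (auto simp: recursive_def)
  from recursive_pair[OF this] show ?thesis by simp
qed

lemma recursive_oracle [recursive_intros]:
  "recursive f \<Longrightarrow> recursive (\<lambda>p n. p (f p n))"
  using recursive_compose[of "\<lambda>p n. p n" f] partial_recursive.oracle_query
  by (simp add: recursive_def)

lemma recursive_rec_nat [recursive_intros]:
  assumes "recursive f"
    and "recursive (\<lambda>p z. g p (pfst z) (pfst (psnd z)) (psnd (psnd z)))"
    and "recursive k"
  shows "recursive (\<lambda>p n. rec_nat (f p n) (g p n) (k p n))"
proof -
  let ?\<Phi> = "\<lambda>p n. Some (f p n)"
  let ?\<Psi> = "\<lambda>p z. Some (g p (pfst z) (pfst (psnd z)) (psnd (psnd z)))"
  have eq: "rec_nat (?\<Phi> p a) (\<lambda>j r. Option.bind r (\<lambda>b. ?\<Psi> p (pair a (pair j b)))) k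
      = Some (rec_nat (f p a) (g p a) k)" for p a k
    by (induction k) auto
  have "partial_recursive (\<lambda>p n. case prod_decode n of (a, k) \<Rightarrow>
      rec_nat (?\<Phi> p a) (\<lambda>j r. Option.bind r (\<lambda>b. ?\<Psi> p (pair a (pair j b)))) k)"
    using assms(1,2) by (intro partial_recursive.prim_rec) (auto simp: recursive_def)
  then have "recursive (\<lambda>p n. rec_nat (f p (pfst n)) (g p (pfst n)) (psnd n))"
    unfolding recursive_def eq by (simp add: case_prod_beta)
  from recursive_compose[OF this, of "\<lambda>p n. pair n (k p n)"] show ?thesis
    using assms(3) by (simp add: recursive_intros)
qed

lemma recursive_add [recursive_intros]:
  assumes "recursive f" "recursive g"
  shows "recursive (\<lambda>p n. f p n + g p n)"
proof -
  have "rec_nat a (\<lambda>_ b. Suc b) k = a + k" for a k :: nat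
    by (induction k) auto
  moreover have "recursive (\<lambda>p n. rec_nat (f p n) (\<lambda>_ b. Suc b) (g p n))"
    by (intro recursive_intros assms)
  ultimately show ?thesis by simp
qed

lemma recursive_mult [recursive_intros]:
  assumes "recursive f" "recursive g"
  shows "recursive (\<lambda>p n. f p n * g p n)"
proof -
  have "rec_nat 0 (\<lambda>_ b. b + a) k = a * k" for a k :: nat
    by (induction k) auto
  moreover have "recursive (\<lambda>p n. rec_nat 0 (\<lambda>_ b. b + f p n) (g p n))"
    by (intro recursive_intros recursive_compose[OF assms(1)] assms)
  ultimately show ?thesis by simp
qed

lemma recursive_diff [recursive_intros]:
  assumes "recursive f" "recursive g"
  shows "recursive (\<lambda>p n. f p n - g p n)"
proof -
  have "rec_nat 0 (\<lambda>j _. j) k = k - 1" for k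
    by (cases k) auto
  moreover have "recursive (\<lambda>p n. rec_nat 0 (\<lambda>j _. j) n)"
    by (intro recursive_intros)
  ultimately have pred: "recursive (\<lambda>p n. n - 1)" by simp
  have "rec_nat a (\<lambda>_ b. b - 1) k = a - k" for a k :: nat
    by (induction k) auto
  moreover have "recursive (\<lambda>p n. rec_nat (f p n) (\<lambda>_ b. b - 1) (g p n))"
    by (intro recursive_intros recursive_compose[OF pred] assms)
  ultimately show ?thesis by simp
qed

lemma recursive_power [recursive_intros]:
  assumes "recursive f" "recursive g"
  shows "recursive (\<lambda>p n. f p n ^ g p n)"
proof -
  have "rec_nat 1 (\<lambda>_ b. a * b) k = a ^ k" for a k :: nat
    by (induction k) auto
  moreover have "recursive (\<lambda>p n. rec_nat 1 (\<lambda>_ b. f p n * b) (g p n))"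
    by (intro recursive_intros recursive_compose[OF assms(1)] assms)
  ultimately show ?thesis by simp
qed

definition decidable :: "(baire \<Rightarrow> nat \<Rightarrow> bool) \<Rightarrow> bool" where
  "decidable P \<longleftrightarrow> recursive (\<lambda>p n. of_bool (P p n))"

lemma decidable_compose:
  "decidable P \<Longrightarrow> recursive f \<Longrightarrow> decidable (\<lambda>p n. P p (f p n))"
  unfolding decidable_def by (rule recursive_compose)

lemma recursive_of_bool [recursive_intros]:
  "decidable P \<Longrightarrow> recursive (\<lambda>p n. of_bool (P p n))"
  by (simp add: decidable_def)

lemma recursive_if [recursive_intros]:
  assumes "decidable P" "recursive f" "recursive g"
  shows "recursive (\<lambda>p n. if P p n then f p n else g p n)"
proof -
  have "recursive (\<lambda>p n. rec_nat (g p n) (\<lambda>_ _. f p n) (of_bool (P p n)))"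
    by (intro recursive_intros recursive_compose[OF assms(2)] assms)
  moreover have "rec_nat (g p n) (\<lambda>_ _. f p n) (of_bool (P p n)) = (if P p n then f p n else g p n)" for p n
    by simp
  ultimately show ?thesis by simp
qed

lemma decidable_not [recursive_intros]:
  assumes "decidable P" shows "decidable (\<lambda>p n. \<not> P p n)"
proof -
  have "recursive (\<lambda>p n. 1 - of_bool (P p n))" by (intro recursive_intros assms)
  moreover have "1 - of_bool (P p n) = (of_bool (\<not> P p n) :: nat)" for p n by simp
  ultimately show ?thesis by (simp add: decidable_def)
qed

lemma decidable_conj [recursive_intros]:
  assumes "decidable P" "decidable Q" shows "decidable (\<lambda>p n. P p n \<and> Q p n)"
proof -
  have "recursive (\<lambda>p n. of_bool (P p n) * of_bool (Q p n))" by (intro recursive_intros assms)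
  moreover have "of_bool (P p n) * of_bool (Q p n) = (of_bool (P p n \<and> Q p n) :: nat)" for p n by simp
  ultimately show ?thesis by (simp add: decidable_def)
qed

lemma decidable_disj [recursive_intros]:
  assumes "decidable P" "decidable Q" shows "decidable (\<lambda>p n. P p n \<or> Q p n)"
  using decidable_not[OF decidable_conj[OF assms[THEN decidable_not]]] by simp

lemma decidable_imp [recursive_intros]:
  assumes "decidable P" "decidable Q" shows "decidable (\<lambda>p n. P p n \<longrightarrow> Q p n)"
  using decidable_disj[OF decidable_not[OF assms(1)] assms(2)] by simp

lemma decidable_less [recursive_intros]:
  assumes "recursive f" "recursive g" shows "decidable (\<lambda>p n. f p n < g p n)"
proof -
  have "recursive (\<lambda>p n. rec_nat 0 (\<lambda>_ _. 1) (g p n - f p n))" by (intro recursive_intros assms)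
  moreover have "rec_nat 0 (\<lambda>_ _. 1) (b - a) = (of_bool (a < b) :: nat)" for a b :: nat
    by (cases "b - a") auto
  ultimately show ?thesis by (simp add: decidable_def)
qed

lemma decidable_le [recursive_intros]:
  assumes "recursive f" "recursive g" shows "decidable (\<lambda>p n. f p n \<le> g p n)"
  using decidable_not[OF decidable_less[OF assms(2,1)]] by (simp add: not_less)

lemma decidable_eq [recursive_intros]:
  assumes "recursive f" "recursive g" shows "decidable (\<lambda>p n. f p n = g p n)"
  using decidable_conj[OF decidable_le[OF assms] decidable_le[OF assms(2,1)]]
  by (simp add: eq_iff)

lemma decidable_bounded_ex [recursive_intros]:
  assumes "recursive f" "decidable (\<lambda>p z. P p (pfst z) (psnd z))"
  shows "decidable (\<lambda>p n. \<exists>k<f p n. P p n k)"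
proof -
  have "recursive (\<lambda>p z. of_bool (P p (pfst z) (psnd z)))"
    using assms(2) by (simp add: decidable_def)
  from recursive_compose[OF this, of "\<lambda>p z. pair (pfst z) (pfst (psnd z))"]
  have "decidable (\<lambda>p z. P p (pfst z) (pfst (psnd z)))"
    by (simp add: decidable_def recursive_intros)
  then have "recursive (\<lambda>p n. rec_nat 0 (\<lambda>k b. if P p n k then 1 else b) (f p n))"
    by (intro recursive_intros assms)
  moreover have "rec_nat 0 (\<lambda>k b. if P p n k then 1 else b) m = (of_bool (\<exists>k<m. P p n k) :: nat)" for p n m
    by (induction m) (auto simp: less_Suc_eq)
  ultimately show ?thesis by (simp add: decidable_def)
qed

lemma decidable_bounded_all [recursive_intros]:
  assumes "recursive f" "decidable (\<lambda>p z. P p (pfst z) (psnd z))"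
  shows "decidable (\<lambda>p n. \<forall>k<f p n. P p n k)"
  using decidable_not[OF decidable_bounded_ex[OF assms(1) decidable_not[OF assms(2)]]] by simp

lemma decidable_even [recursive_intros]:
  assumes "recursive f" shows "decidable (\<lambda>p n. even (f p n))"
proof -
  have "decidable (\<lambda>p n. \<exists>k<Suc n. n = 2 * k)"
    by (intro recursive_intros)
  moreover have "(\<exists>k<Suc n. n = 2 * k) \<longleftrightarrow> even n" for n :: nat
    by (auto elim!: evenE)
  ultimately show ?thesis using decidable_compose[OF _ assms] by simp
qed

lemma recursive_half [recursive_intros]:
  assumes "recursive f" shows "recursive (\<lambda>p n. f p n div 2)"
proof -
  have "recursive (\<lambda>p n. rec_nat 0 (\<lambda>j b. if even j then b else Suc b) n)"
    by (intro recursive_intros)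
  moreover have "rec_nat 0 (\<lambda>j b. if even j then b else Suc b) n = n div 2" for n
    by (induction n) auto
  ultimately show ?thesis using recursive_compose[OF _ assms] by simp
qed

text \<open>
  The zeros of the characteristic function of the complement are searched; this function is
  total, so the search cannot get stuck before the first zero.
\<close>

lemma partial_recursive_Least:
  assumes "decidable (\<lambda>p z. P p (pfst z) (psnd z))"
  shows "partial_recursive (\<lambda>p n. if \<exists>k. P p n k then Some (LEAST k. P p n k) else None)"
  using partial_recursive.mu[OF recursive_of_bool[OF decidable_not[OF assms], unfolded recursive_def]]
  by (simp cong: if_cong)

lemma recursive_Least [recursive_intros]:
  assumes "decidable (\<lambda>p z. P p (pfst z) (psnd z))" "\<And>p n. \<exists>k. P p n k"
  shows "recursive (\<lambda>p n. LEAST k. P p n k)"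
  using partial_recursive_Least[OF assms(1)] assms(2) by (simp add: recursive_def)


section \<open>Semidecidable predicates and selection\<close>

definition semidecidable :: "(baire \<Rightarrow> nat \<Rightarrow> bool) \<Rightarrow> bool" where
  "semidecidable P \<longleftrightarrow> (\<exists>R. decidable R \<and> (\<forall>p n. P p n \<longleftrightarrow> (\<exists>u. R p (pair n u))))"

named_theorems semidecidable_intros

lemma semidecidableI:
  assumes "decidable (\<lambda>p z. R p (pfst z) (psnd z))" "\<And>p n. P p n \<longleftrightarrow> (\<exists>u. R p n u)"
  shows "semidecidable P"
  unfolding semidecidable_def using assms by (intro exI[of _ "\<lambda>p z. R p (pfst z) (psnd z)"]) simp

lemma semidecidableE:
  assumes "semidecidable P"
  obtains R where "decidable (\<lambda>p z. R p (pfst z) (psnd z))" "\<And>p n. P p n \<longleftrightarrow> (\<exists>u. R p n u)"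
proof -
  obtain R where R: "decidable R" "\<And>p n. P p n \<longleftrightarrow> (\<exists>u. R p (pair n u))"
    using assms unfolding semidecidable_def by blast
  show ?thesis
    using R by (intro that[of "\<lambda>p n u. R p (pair n u)"]) auto
qed

lemma decidable_compose2:
  assumes "decidable (\<lambda>p z. R p (pfst z) (psnd z))" "recursive f" "recursive g"
  shows "decidable (\<lambda>p n. R p (f p n) (g p n))"
  using decidable_compose[OF assms(1) recursive_pair[OF assms(2,3)]] by simp

lemma semidecidable_compose:
  assumes "semidecidable P" "recursive f"
  shows "semidecidable (\<lambda>p n. P p (f p n))"
proof -
  obtain R where R: "decidable (\<lambda>p z. R p (pfst z) (psnd z))" "\<And>p n. P p n \<longleftrightarrow> (\<exists>u. R p n u)"
    using semidecidableE[OF assms(1)] by blast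
  show ?thesis
    by (rule semidecidableI[of "\<lambda>p n u. R p (f p n) u"])
      (auto intro!: decidable_compose2[OF R(1)] recursive_compose[OF assms(2)] recursive_intros simp: R(2))
qed

lemma semidecidable_compose2:
  assumes "semidecidable (\<lambda>p z. S p (pfst z) (psnd z))" "recursive f" "recursive g"
  shows "semidecidable (\<lambda>p n. S p (f p n) (g p n))"
  using semidecidable_compose[OF assms(1) recursive_pair[OF assms(2,3)]] by simp

lemma decidable_imp_semidecidable:
  assumes "decidable P" shows "semidecidable P"
  by (rule semidecidableI[of "\<lambda>p n u. P p n"]) (auto intro!: decidable_compose[OF assms] recursive_intros)

lemma semidecidable_ex [semidecidable_intros]:
  assumes "semidecidable (\<lambda>p z. P p (pfst z) (psnd z))"
  shows "semidecidable (\<lambda>p n. \<exists>k. P p n k)"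
proof -
  obtain R where R: "decidable (\<lambda>p z. R p (pfst z) (psnd z))"
    "\<And>p z. P p (pfst z) (psnd z) \<longleftrightarrow> (\<exists>u. R p z u)"
    using semidecidableE[OF assms] by blast
  have eq: "P p n k \<longleftrightarrow> (\<exists>u. R p (pair n k) u)" for p n k
    using R(2)[of p "pair n k"] by simp
  show ?thesis
    by (rule semidecidableI[of "\<lambda>p n u. R p (pair n (pfst u)) (psnd u)"])
      (auto intro!: decidable_compose2[OF R(1)] recursive_intros simp: eq,
        metis fst_conv snd_conv prod_encode_inverse)
qed

lemma semidecidable_conj [semidecidable_intros]:
  assumes "semidecidable P" "semidecidable Q"
  shows "semidecidable (\<lambda>p n. P p n \<and> Q p n)"
proof -
  obtain R where R: "decidable (\<lambda>p z. R p (pfst z) (psnd z))" "\<And>p n. P p n \<longleftrightarrow> (\<exists>u. R p n u)"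
    using semidecidableE[OF assms(1)] by blast
  obtain R' where R': "decidable (\<lambda>p z. R' p (pfst z) (psnd z))" "\<And>p n. Q p n \<longleftrightarrow> (\<exists>u. R' p n u)"
    using semidecidableE[OF assms(2)] by blast
  show ?thesis
    by (rule semidecidableI[of "\<lambda>p n u. R p n (pfst u) \<and> R' p n (psnd u)"])
      (auto intro!: decidable_compose2[OF R(1)] decidable_compose2[OF R'(1)] recursive_intros
        simp: R(2) R'(2), metis fst_conv snd_conv prod_encode_inverse)
qed

lemma semidecidable_disj [semidecidable_intros]:
  assumes "semidecidable P" "semidecidable Q"
  shows "semidecidable (\<lambda>p n. P p n \<or> Q p n)"
proof -
  obtain R where R: "decidable (\<lambda>p z. R p (pfst z) (psnd z))" "\<And>p n. P p n \<longleftrightarrow> (\<exists>u. R p n u)"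
    using semidecidableE[OF assms(1)] by blast
  obtain R' where R': "decidable (\<lambda>p z. R' p (pfst z) (psnd z))" "\<And>p n. Q p n \<longleftrightarrow> (\<exists>u. R' p n u)"
    using semidecidableE[OF assms(2)] by blast
  show ?thesis
    by (rule semidecidableI[of "\<lambda>p n u. R p n u \<or> R' p n u"])
      (auto intro!: R(1) R'(1) recursive_intros simp: R(2) R'(2))
qed

text \<open>
  Finitely many witnesses have a common bound, and this bound is a witness for all of them.
\<close>

lemma semidecidable_bounded_all [semidecidable_intros]:
  assumes "recursive f" "semidecidable (\<lambda>p z. P p (pfst z) (psnd z))"
  shows "semidecidable (\<lambda>p n. \<forall>k<f p n. P p n k)"
proof -
  obtain R where R: "decidable (\<lambda>p z. R p (pfst z) (psnd z))"
    "\<And>p z. P p (pfst z) (psnd z) \<longleftrightarrow> (\<exists>u. R p z u)"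
    using semidecidableE[OF assms(2)] by blast
  have eq: "P p n k \<longleftrightarrow> (\<exists>u. R p (pair n k) u)" for p n k
    using R(2)[of p "pair n k"] by simp
  have bound: "\<exists>u. \<forall>k<m. \<exists>v<u. R p (pair n k) v" if "\<forall>k<m. \<exists>u. R p (pair n k) u" for p n m
  proof -
    have "\<forall>k\<in>{..<m}. \<exists>u. R p (pair n k) u"
      using that by simp
    from bchoice[OF this] obtain g where g: "\<forall>k\<in>{..<m}. R p (pair n k) (g k)"
      by blast
    have "g k < Suc (\<Sum>k<m. g k)" if "k < m" for k
      using member_le_sum[of k "{..<m}" g] that by auto
    then show ?thesis using g by blast
  qed
  show ?thesis
    by (rule semidecidableI[of "\<lambda>p n u. \<forall>k<f p n. \<exists>v<u. R p (pair n k) v"])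
      (auto intro!: decidable_compose2[OF R(1)] recursive_intros recursive_compose[OF assms(1)]
        simp: eq, metis bound)
qed

text \<open>
  The search runs through pairs of a value and a witness for it, in the order of their codes.
\<close>

lemma semidecidable_selection:
  assumes "semidecidable (\<lambda>p z. S p (pfst z) (psnd z))"
  obtains \<Phi> where "partial_recursive \<Phi>"
    "\<And>p n. \<exists>v. S p n v \<Longrightarrow> \<exists>v. \<Phi> p n = Some v \<and> S p n v"
proof -
  obtain R where R: "decidable (\<lambda>p z. R p (pfst z) (psnd z))"
    "\<And>p z. S p (pfst z) (psnd z) \<longleftrightarrow> (\<exists>u. R p z u)"
    using semidecidableE[OF assms] by blast
  have eq: "S p n k \<longleftrightarrow> (\<exists>u. R p (pair n k) u)" for p n k
    using R(2)[of p "pair n k"] by simp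
  let ?P = "\<lambda>p n u. R p (pair n (pfst u)) (psnd u)"
  let ?\<Phi> = "\<lambda>p n. if \<exists>u. ?P p n u then Some (LEAST u. ?P p n u) else None"
  have "partial_recursive ?\<Phi>"
    by (intro partial_recursive_Least decidable_compose2[OF R(1)] recursive_intros)
  from partial_recursive.comp[OF partial_recursive.left this]
  have "partial_recursive (\<lambda>p n. Option.bind (?\<Phi> p n) (\<lambda>u. Some (pfst u)))" .
  moreover have "\<exists>v. Option.bind (?\<Phi> p n) (\<lambda>u. Some (pfst u)) = Some v \<and> S p n v"
    if "\<exists>v. S p n v" for p n
  proof -
    have ex: "\<exists>u. ?P p n u"
      using that unfolding eq by (metis fst_conv snd_conv prod_encode_inverse)
    then have "?P p n (LEAST u. ?P p n u)"
      by (rule LeastI_ex)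
    then show ?thesis using ex by (auto simp: eq)
  qed
  ultimately show ?thesis by (rule that)
qed

lemma semidecidable_choice:
  assumes "semidecidable (\<lambda>p z. S p (pfst z) (psnd z))" "\<And>p n. \<exists>v. S p n v"
  obtains f where "recursive f" "\<And>p n. S p n (f p n)"
proof -
  obtain \<Phi> where \<Phi>: "partial_recursive \<Phi>" "\<And>p n. \<exists>v. \<Phi> p n = Some v \<and> S p n v"
    using semidecidable_selection[OF assms(1)] assms(2) by metis
  have "\<Phi> = (\<lambda>p n. Some (the (\<Phi> p n)))"
    using \<Phi>(2) by (metis option.sel)
  with \<Phi> show ?thesis
    by (intro that[of "\<lambda>p n. the (\<Phi> p n)"]) (auto simp: recursive_def, metis option.sel)
qed

text \<open>
  Here \<open>u\<close> is the first pair of a value and a witness for it. Since \<open>T\<close> is decidable, one can list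
  the selected values by running through all \<open>u\<close>, also for those \<open>n\<close> that have no value at all and
  for which the search of a selection function would diverge.
\<close>

lemma semidecidable_uniformization:
  assumes "semidecidable (\<lambda>p z. S p (pfst z) (psnd z))"
  obtains T where "decidable (\<lambda>p z. T p (pfst z) (psnd z))"
    "\<And>p n u. T p n u \<Longrightarrow> S p n (pfst u)"
    "\<And>p n u v. T p n u \<Longrightarrow> T p n v \<Longrightarrow> u = v"
    "\<And>p n v. S p n v \<Longrightarrow> \<exists>u. T p n u"
proof -
  obtain R where R: "decidable (\<lambda>p z. R p (pfst z) (psnd z))"
    "\<And>p z. S p (pfst z) (psnd z) \<longleftrightarrow> (\<exists>u. R p z u)"
    using semidecidableE[OF assms] by blast
  have eq: "S p n k \<longleftrightarrow> (\<exists>u. R p (pair n k) u)" for p n k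
    using R(2)[of p "pair n k"] by simp
  let ?P = "\<lambda>p n u. R p (pair n (pfst u)) (psnd u)"
  let ?T = "\<lambda>p n u. ?P p n u \<and> (\<forall>v<u. \<not> ?P p n v)"
  show ?thesis
  proof (rule that[of ?T])
    show "decidable (\<lambda>p z. ?T p (pfst z) (psnd z))"
      by (intro decidable_compose2[OF R(1)] recursive_intros)
    show "S p n (pfst u)" if "?T p n u" for p n u
      using that eq by blast
    show "u = v" if "?T p n u" "?T p n v" for p n u v
      using that by (metis nat_neq_iff)
    show "\<exists>u. ?T p n u" if S: "S p n v" for p n v
    proof -
      have "\<exists>u. ?P p n u"
        using S unfolding eq by (metis fst_conv snd_conv prod_encode_inverse)
      then show ?thesis
        using LeastI_ex[of "?P p n"] not_less_Least[of _ "?P p n"] by blast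
    qed
  qed
qed

section \<open>Composition of computable functions\<close>

text \<open>
  Kleene's schemes do not refer to the oracle except through queries. Hence answering the queries
  to \<open>q\<close> by a program for \<open>q\<close> turns every derivation into one that is relative to \<open>p\<close>.
\<close>

lemma partial_recursive_substitution:
  assumes "partial_recursive \<Psi>" "partial_recursive \<Phi>"
  shows "\<exists>\<Theta>. partial_recursive \<Theta> \<and> (\<forall>p q. (\<forall>n. \<Phi> p n = Some (q n)) \<longrightarrow> \<Theta> p = \<Psi> q)"
  using assms(1)
proof (induction rule: partial_recursive.induct)
  case oracle_query
  have "\<Phi> p = (\<lambda>n. Some (q n))" if "\<forall>n. \<Phi> p n = Some (q n)" for p q
    using that by blast
  with assms(2) show ?case by blast
next
  case (pair \<Psi>1 \<Psi>2)
  then obtain \<Theta>1 \<Theta>2 where \<Theta>: "partial_recursive \<Theta>1" "partial_recursive \<Theta>2"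
    "\<And>p q. (\<forall>n. \<Phi> p n = Some (q n)) \<Longrightarrow> \<Theta>1 p = \<Psi>1 q"
    "\<And>p q. (\<forall>n. \<Phi> p n = Some (q n)) \<Longrightarrow> \<Theta>2 p = \<Psi>2 q"
    by metis
  have "(\<lambda>n. Option.bind (\<Theta>1 p n) (\<lambda>a. Option.bind (\<Theta>2 p n) (\<lambda>b. Some (prod_encode (a, b)))))
      = (\<lambda>n. Option.bind (\<Psi>1 q n) (\<lambda>a. Option.bind (\<Psi>2 q n) (\<lambda>b. Some (prod_encode (a, b)))))"
    if "\<forall>n. \<Phi> p n = Some (q n)" for p q
    by (simp only: \<Theta>(3)[OF that] \<Theta>(4)[OF that])
  with partial_recursive.pair[OF \<Theta>(1,2)] show ?case
    by blast
next
  case (comp \<Psi>1 \<Psi>2)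
  then obtain \<Theta>1 \<Theta>2 where \<Theta>: "partial_recursive \<Theta>1" "partial_recursive \<Theta>2"
    "\<And>p q. (\<forall>n. \<Phi> p n = Some (q n)) \<Longrightarrow> \<Theta>1 p = \<Psi>1 q"
    "\<And>p q. (\<forall>n. \<Phi> p n = Some (q n)) \<Longrightarrow> \<Theta>2 p = \<Psi>2 q"
    by metis
  have "(\<lambda>n. Option.bind (\<Theta>2 p n) (\<Theta>1 p))
      = (\<lambda>n. Option.bind (\<Psi>2 q n) (\<Psi>1 q))"
    if "\<forall>n. \<Phi> p n = Some (q n)" for p q
    by (simp only: \<Theta>(3)[OF that] \<Theta>(4)[OF that])
  with partial_recursive.comp[OF \<Theta>(1,2)] show ?case
    by blast
next
  case (prim_rec \<Psi>1 \<Psi>2)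
  then obtain \<Theta>1 \<Theta>2 where \<Theta>: "partial_recursive \<Theta>1" "partial_recursive \<Theta>2"
    "\<And>p q. (\<forall>n. \<Phi> p n = Some (q n)) \<Longrightarrow> \<Theta>1 p = \<Psi>1 q"
    "\<And>p q. (\<forall>n. \<Phi> p n = Some (q n)) \<Longrightarrow> \<Theta>2 p = \<Psi>2 q"
    by metis
  have "(\<lambda>n. case prod_decode n of (a, k) \<Rightarrow>
           rec_nat (\<Theta>1 p a)
             (\<lambda>j r. Option.bind r (\<lambda>b. \<Theta>2 p (prod_encode (a, prod_encode (j, b))))) k)
      = (\<lambda>n. case prod_decode n of (a, k) \<Rightarrow>
           rec_nat (\<Psi>1 q a)
             (\<lambda>j r. Option.bind r (\<lambda>b. \<Psi>2 q (prod_encode (a, prod_encode (j, b))))) k)"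
    if "\<forall>n. \<Phi> p n = Some (q n)" for p q
    by (simp only: \<Theta>(3)[OF that] \<Theta>(4)[OF that])
  with partial_recursive.prim_rec[OF \<Theta>(1,2)] show ?case
    by blast
next
  case (mu \<Psi>1)
  then obtain \<Theta>1 where \<Theta>: "partial_recursive \<Theta>1"
    "\<And>p q. (\<forall>n. \<Phi> p n = Some (q n)) \<Longrightarrow> \<Theta>1 p = \<Psi>1 q"
    by metis
  have "(\<lambda>n. if \<exists>k. \<Theta>1 p (prod_encode (n, k)) = Some 0 \<and> (\<forall>j<k. \<Theta>1 p (prod_encode (n, j)) \<noteq> None)
           then Some (LEAST k. \<Theta>1 p (prod_encode (n, k)) = Some 0) else None)
      = (\<lambda>n. if \<exists>k. \<Psi>1 q (prod_encode (n, k)) = Some 0 \<and> (\<forall>j<k. \<Psi>1 q (prod_encode (n, j)) \<noteq> None)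
           then Some (LEAST k. \<Psi>1 q (prod_encode (n, k)) = Some 0) else None)"
    if "\<forall>n. \<Phi> p n = Some (q n)" for p q
    by (simp only: \<Theta>(2)[OF that])
  with partial_recursive.mu[OF \<Theta>(1)] show ?case
    by blast
qed (blast intro: partial_recursive.intros)+

lemma computable_map_comp:
  assumes "computable F" "computable G"
  shows "computable (F \<circ>\<^sub>m G)"
proof -
  obtain \<Psi> where \<Psi>: "partial_recursive \<Psi>" "\<And>p q n. F p = Some q \<Longrightarrow> \<Psi> p n = Some (q n)"
    using assms(1) unfolding computable_def by blast
  obtain \<Phi> where \<Phi>: "partial_recursive \<Phi>" "\<And>p q n. G p = Some q \<Longrightarrow> \<Phi> p n = Some (q n)"
    using assms(2) unfolding computable_def by blast
  obtain \<Theta> where \<Theta>: "partial_recursive \<Theta>"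
    "\<And>p q. (\<forall>n. \<Phi> p n = Some (q n)) \<Longrightarrow> \<Theta> p = \<Psi> q"
    using partial_recursive_substitution[OF \<Psi>(1) \<Phi>(1)] by blast
  have "\<Theta> p n = Some (r n)" if r: "(F \<circ>\<^sub>m G) p = Some r" for p r n
  proof -
    obtain q where q: "G p = Some q" "F q = Some r"
      using r by (auto simp: map_comp_def split: option.splits)
    then have "\<Theta> p = \<Psi> q"
      using \<Phi>(2) \<Theta>(2) by blast
    then show ?thesis
      using q(2) \<Psi>(2) by simp
  qed
  then show ?thesis
    unfolding computable_def using \<Theta>(1) by blast
qed

section \<open>Predicates without oracle\<close>

text \<open>
  A program chosen for an oracle-free predicate may still use its oracle and give different results
  for different oracles. Fixing the oracle makes objects constructed in this way independent of it.
\<close>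

lemma recursive_fixed_oracle:
  assumes "recursive f" shows "recursive (\<lambda>p n. f (\<lambda>_. 0) n)"
proof -
  obtain \<Theta> where "partial_recursive \<Theta>" "\<And>p. \<Theta> p = (\<lambda>n. Some (f (\<lambda>_. 0) n))"
    using partial_recursive_substitution[OF assms[unfolded recursive_def] partial_recursive.zero]
    by metis
  moreover from this have "\<Theta> = (\<lambda>p n. Some (f (\<lambda>_. 0) n))" by blast
  ultimately show ?thesis by (simp add: recursive_def)
qed

lemma semidecidable_oracle_freeE:
  assumes "semidecidable (\<lambda>p n. P n)"
  obtains R where "decidable (\<lambda>p z. R (pfst z) (psnd z))" "\<And>n. P n \<longleftrightarrow> (\<exists>u. R n u)"
proof -
  obtain R where R: "decidable (\<lambda>p z. R p (pfst z) (psnd z))" "\<And>p n. P n \<longleftrightarrow> (\<exists>u. R p n u)"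
    using semidecidableE[OF assms] by blast
  have "decidable (\<lambda>p z. R (\<lambda>_. 0) (pfst z) (psnd z))"
    using recursive_fixed_oracle[OF R(1)[unfolded decidable_def]] by (simp add: decidable_def)
  then show ?thesis using R(2) by (rule that)
qed

lemma semidecidable_choice_oracle_free:
  assumes "semidecidable (\<lambda>p z. S (pfst z) (psnd z))" "\<And>n. \<exists>v. S n v"
  obtains f where "recursive (\<lambda>p. f)" "\<And>n. S n (f n)"
proof -
  obtain f where f: "recursive f" "\<And>p n. S n (f p n)"
    using semidecidable_choice[OF assms(1)] assms(2) by blast
  show ?thesis
    using recursive_fixed_oracle[OF f(1)] f(2) by (rule that)
qed

text \<open>
  Post's theorem: exactly one of the two searches succeeds, and which one is the answer.
\<close>

lemma decidable_by_complement:
  assumes "semidecidable (\<lambda>p n. P n)" "semidecidable (\<lambda>p n. \<not> P n)"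
  shows "decidable (\<lambda>p n. P n)"
proof -
  have "semidecidable (\<lambda>p z. (P (pfst z) \<and> psnd z = 1) \<or> (\<not> P (pfst z) \<and> psnd z = 0))"
    by (intro semidecidable_intros semidecidable_compose[OF assms(1)] semidecidable_compose[OF assms(2)]
      decidable_imp_semidecidable recursive_intros)
  then obtain f where f: "recursive (\<lambda>p. f)" "\<And>n. (P n \<and> f n = 1) \<or> (\<not> P n \<and> f n = 0)"
    by (rule semidecidable_choice_oracle_free[where S = "\<lambda>n v. (P n \<and> v = 1) \<or> (\<not> P n \<and> v = 0)"]) blast+
  have "f = (\<lambda>n. of_bool (P n))"
    using f(2) by fastforce
  then show ?thesis using f(1) by (simp add: decidable_def)
qed

section \<open>Strong Weihrauch reducibility\<close>

lemma sW_reducible_trans: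
  assumes "f \<le>\<^sub>s\<^sub>W g" "g \<le>\<^sub>s\<^sub>W h"
  shows "f \<le>\<^sub>s\<^sub>W h"
proof -
  obtain K H where KH: "computable K" "computable H" "\<And>G. G \<turnstile> g \<Longrightarrow> (H \<circ>\<^sub>m G \<circ>\<^sub>m K) \<turnstile> f"
    using assms(1) unfolding sW_reducible_def by blast
  obtain K' H' where KH': "computable K'" "computable H'" "\<And>G. G \<turnstile> h \<Longrightarrow> (H' \<circ>\<^sub>m G \<circ>\<^sub>m K') \<turnstile> g"
    using assms(2) unfolding sW_reducible_def by blast
  have "((H \<circ>\<^sub>m H') \<circ>\<^sub>m G \<circ>\<^sub>m (K' \<circ>\<^sub>m K)) \<turnstile> f" if "G \<turnstile> h" for G
  proof -
    have "(H \<circ>\<^sub>m H') \<circ>\<^sub>m G \<circ>\<^sub>m (K' \<circ>\<^sub>m K) = H \<circ>\<^sub>m (H' \<circ>\<^sub>m G \<circ>\<^sub>m K') \<circ>\<^sub>m K"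
      by (rule ext) (auto simp: map_comp_def split: option.splits)
    then show ?thesis using KH(3)[OF KH'(3)[OF that]] by simp
  qed
  moreover have "computable (K' \<circ>\<^sub>m K)" "computable (H \<circ>\<^sub>m H')"
    using KH KH' by (simp_all add: computable_map_comp)
  ultimately show ?thesis
    unfolding sW_reducible_def by (intro exI conjI allI impI)
qed

text \<open>
  The outer function is given by its program: it is defined on those \<open>q\<close> for which the program is
  total. This leaves one condition on names, in which realizers no longer occur.
\<close>

lemma sW_reducibleI:
  assumes k: "recursive k" and \<Phi>: "partial_recursive \<Phi>"
    and input: "\<And>p x. in_rep f p = Some x \<Longrightarrow> x \<in> mv_dom (multi f) \<Longrightarrow>
      \<exists>u. in_rep g (k p) = Some u \<and> u \<in> mv_dom (multi g) \<and>
        (\<forall>q y. out_rep g q = Some y \<and> y \<in> multi g u \<longrightarrow>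
          (\<exists>r z. (\<forall>n. \<Phi> q n = Some (r n)) \<and> out_rep f r = Some z \<and> z \<in> multi f x))"
  shows "f \<le>\<^sub>s\<^sub>W g"
proof -
  define H where "H q = (if \<forall>n. \<Phi> q n \<noteq> None then Some (\<lambda>n. the (\<Phi> q n)) else None)" for q
  have H: "H q = Some r" if "\<forall>n. \<Phi> q n = Some (r n)" for q r
    using that by (simp add: H_def)
  have "computable H"
    unfolding computable_def H_def using \<Phi> by (intro exI[of _ \<Phi>]) (auto split: if_splits)
  moreover have "computable (\<lambda>p. Some (k p))"
    using k unfolding computable_def recursive_def by blast
  moreover have "(H \<circ>\<^sub>m G \<circ>\<^sub>m (\<lambda>p. Some (k p))) \<turnstile> f" if G: "G \<turnstile> g" for G
    unfolding realizes_def
  proof (intro allI impI, elim conjE)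
    fix p x assume p: "in_rep f p = Some x" "x \<in> mv_dom (multi f)"
    obtain u where u: "in_rep g (k p) = Some u" "u \<in> mv_dom (multi g)"
      "\<And>q y. out_rep g q = Some y \<Longrightarrow> y \<in> multi g u \<Longrightarrow>
          (\<exists>r z. (\<forall>n. \<Phi> q n = Some (r n)) \<and> out_rep f r = Some z \<and> z \<in> multi f x)"
      using input[OF p] by blast
    obtain q y where q: "G (k p) = Some q" "out_rep g q = Some y" "y \<in> multi g u"
      using G u(1,2) unfolding realizes_def by blast
    then obtain r z where "\<forall>n. \<Phi> q n = Some (r n)" "out_rep f r = Some z" "z \<in> multi f x"
      using u(3) by blast
    then show "\<exists>q y. (H \<circ>\<^sub>m G \<circ>\<^sub>m (\<lambda>p. Some (k p))) p = Some q \<and> out_rep f q = Some y \<and> y \<in> multi f x"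
      using H q(1) by (auto simp: map_comp_def)
  qed
  ultimately show ?thesis
    unfolding sW_reducible_def by blast
qed

section \<open>Computable real numbers\<close>

definition rat_value :: "nat \<Rightarrow> real" where
  "rat_value c = (real (pfst (pfst c)) - real (psnd (pfst c))) / real (Suc (psnd c))"

lemma real_of_rat_enum: "real_of_rat (rat_enum c) = rat_value c"
  by (simp add: rat_enum_def rat_value_def case_prod_beta of_rat_divide of_rat_diff of_rat_add)

lemma rat_value_surj:
  assumes "q \<in> \<rat>" shows "\<exists>c. rat_value c = q"
proof -
  obtain a b where ab: "q = of_int a / of_int b" "b > 0"
    using assms by (elim Rats_cases') auto
  have "rat_value (pair (pair (nat a) (nat (- a))) (nat b - 1)) = q"
    using ab by (auto simp: rat_value_def)
  then show ?thesis by blast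
qed

lemma rat_value_between:
  assumes "x < y" shows "\<exists>c. x < rat_value c \<and> rat_value c < y"
proof -
  obtain q where "q \<in> \<rat>" "x < q" "q < y"
    using Rats_dense_in_real[OF assms] by blast
  then show ?thesis using rat_value_surj by blast
qed

lemma ex_inverse_power_less:
  assumes "0 < (x :: real)" shows "\<exists>k. 1 / 2 ^ k < x"
  using reals_power_lt_ex[OF assms, of 2] by (auto simp: power_one_over)

lemma ex_twice_inverse_power_less:
  assumes "0 < (x :: real)" shows "\<exists>k. 1 / 2 ^ k + 1 / 2 ^ k < x"
proof -
  obtain k where "1 / 2 ^ k < x"
    using ex_inverse_power_less[OF assms] ..
  then have "1 / 2 ^ Suc k + 1 / 2 ^ Suc k < x"
    by simp
  then show ?thesis ..
qed

text \<open>
  Approximation from both sides is what makes sums and differences computable, and one strict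
  inequality between two such numbers semidecidable.
\<close>

definition computable_real :: "(baire \<Rightarrow> nat \<Rightarrow> real) \<Rightarrow> bool" where
  "computable_real \<rho> \<longleftrightarrow>
     (\<exists>a. recursive a \<and> (\<forall>p n k. \<bar>\<rho> p n - rat_value (a p (pair n k))\<bar> \<le> 1 / 2 ^ k))"

named_theorems computable_real_intros

lemma computable_realI:
  assumes "recursive (\<lambda>p z. a p (pfst z) (psnd z))" "\<And>p n k. \<bar>\<rho> p n - rat_value (a p n k)\<bar> \<le> 1 / 2 ^ k"
  shows "computable_real \<rho>"
  unfolding computable_real_def
  using assms by (intro exI[of _ "\<lambda>p z. a p (pfst z) (psnd z)"]) simp

lemma computable_realE:
  assumes "computable_real \<rho>"
  obtains a where "\<And>f g. recursive f \<Longrightarrow> recursive g \<Longrightarrow> recursive (\<lambda>p n. a p (f p n) (g p n))"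
    "\<And>p n k. \<bar>\<rho> p n - rat_value (a p n k)\<bar> \<le> 1 / 2 ^ k"
proof -
  obtain a where a: "recursive a" "\<And>p n k. \<bar>\<rho> p n - rat_value (a p (pair n k))\<bar> \<le> 1 / 2 ^ k"
    using assms unfolding computable_real_def by blast
  show ?thesis
    by (rule that[of "\<lambda>p n k. a p (pair n k)"]) (auto intro!: recursive_compose[OF a(1)] recursive_intros a(2))
qed

lemma computable_real_compose:
  assumes "computable_real \<rho>" "recursive f"
  shows "computable_real (\<lambda>p n. \<rho> p (f p n))"
proof -
  obtain a where a: "\<And>f g. recursive f \<Longrightarrow> recursive g \<Longrightarrow> recursive (\<lambda>p n. a p (f p n) (g p n))"
    "\<And>p n k. \<bar>\<rho> p n - rat_value (a p n k)\<bar> \<le> 1 / 2 ^ k"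
    using computable_realE[OF assms(1)] by blast
  show ?thesis
    by (rule computable_realI[of "\<lambda>p n k. a p (f p n) k"])
      (auto intro!: a recursive_compose[OF assms(2)] recursive_intros)
qed

lemma computable_real_rat_value [computable_real_intros]:
  assumes "recursive f" shows "computable_real (\<lambda>p n. rat_value (f p n))"
  by (rule computable_realI[of "\<lambda>p n k. f p n"]) (auto intro!: recursive_compose[OF assms] recursive_intros)

lemma computable_real_add [computable_real_intros]:
  assumes "computable_real \<rho>" "computable_real \<sigma>"
  shows "computable_real (\<lambda>p n. \<rho> p n + \<sigma> p n)"
proof -
  obtain a where a: "\<And>f g. recursive f \<Longrightarrow> recursive g \<Longrightarrow> recursive (\<lambda>p n. a p (f p n) (g p n))"
    "\<And>p n k. \<bar>\<rho> p n - rat_value (a p n k)\<bar> \<le> 1 / 2 ^ k"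
    using computable_realE[OF assms(1)] by blast
  obtain b where b: "\<And>f g. recursive f \<Longrightarrow> recursive g \<Longrightarrow> recursive (\<lambda>p n. b p (f p n) (g p n))"
    "\<And>p n k. \<bar>\<sigma> p n - rat_value (b p n k)\<bar> \<le> 1 / 2 ^ k"
    using computable_realE[OF assms(2)] by blast
  define plus where "plus x y = pair
      (pair (pfst (pfst x) * Suc (psnd y) + pfst (pfst y) * Suc (psnd x))
         (psnd (pfst x) * Suc (psnd y) + psnd (pfst y) * Suc (psnd x)))
      (Suc (psnd x) * Suc (psnd y) - 1)" for x y
  have plus: "rat_value (plus x y) = rat_value x + rat_value y" for x y
    by (simp add: rat_value_def plus_def field_simps del: of_nat_Suc)
      (simp add: algebra_simps)
  show ?thesis
  proof (rule computable_realI[of "\<lambda>p n k. plus (a p n (Suc k)) (b p n (Suc k))"])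
    show "recursive (\<lambda>p z. plus (a p (pfst z) (Suc (psnd z))) (b p (pfst z) (Suc (psnd z))))"
      unfolding plus_def by (intro recursive_intros a b)
    show "\<bar>\<rho> p n + \<sigma> p n - rat_value (plus (a p n (Suc k)) (b p n (Suc k)))\<bar> \<le> 1 / 2 ^ k" for p n k
      using a(2)[of p n "Suc k"] b(2)[of p n "Suc k"] unfolding plus by simp
  qed
qed

lemma computable_real_uminus [computable_real_intros]:
  assumes "computable_real \<rho>" shows "computable_real (\<lambda>p n. - \<rho> p n)"
proof -
  obtain a where a: "\<And>f g. recursive f \<Longrightarrow> recursive g \<Longrightarrow> recursive (\<lambda>p n. a p (f p n) (g p n))"
    "\<And>p n k. \<bar>\<rho> p n - rat_value (a p n k)\<bar> \<le> 1 / 2 ^ k"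
    using computable_realE[OF assms(1)] by blast
  define neg where "neg x = pair (pair (psnd (pfst x)) (pfst (pfst x))) (psnd x)" for x
  have neg: "rat_value (neg x) = - rat_value x" for x
    by (simp add: rat_value_def neg_def field_simps)
  show ?thesis
  proof (rule computable_realI[of "\<lambda>p n k. neg (a p n k)"])
    show "recursive (\<lambda>p z. neg (a p (pfst z) (psnd z)))"
      unfolding neg_def by (intro recursive_intros a)
    show "\<bar>- \<rho> p n - rat_value (neg (a p n k))\<bar> \<le> 1 / 2 ^ k" for p n k
      using a(2)[of p n k] unfolding neg by simp
  qed
qed

lemma computable_real_diff [computable_real_intros]:
  assumes "computable_real \<rho>" "computable_real \<sigma>"
  shows "computable_real (\<lambda>p n. \<rho> p n - \<sigma> p n)"
  using computable_real_add[OF assms(1) computable_real_uminus[OF assms(2)]] by simp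

lemma computable_real_inverse_power [computable_real_intros]:
  assumes "recursive f" shows "computable_real (\<lambda>p n. 1 / 2 ^ f p n)"
proof -
  have "rat_value (pair (pair 1 0) (2 ^ k - 1)) = 1 / 2 ^ k" for k
    by (simp add: rat_value_def del: of_nat_Suc)
  moreover have "computable_real (\<lambda>p n. rat_value (pair (pair 1 0) (2 ^ f p n - 1)))"
    by (intro computable_real_intros recursive_intros assms)
  ultimately show ?thesis by simp
qed

lemma semidecidable_less [semidecidable_intros]:
  assumes "computable_real \<rho>" "computable_real \<sigma>"
  shows "semidecidable (\<lambda>p n. \<rho> p n < \<sigma> p n)"
proof -
  obtain a where a: "\<And>f g. recursive f \<Longrightarrow> recursive g \<Longrightarrow> recursive (\<lambda>p n. a p (f p n) (g p n))"
    "\<And>p n k. \<bar>(\<sigma> p n - \<rho> p n) - rat_value (a p n k)\<bar> \<le> 1 / 2 ^ k"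
    using computable_realE[OF computable_real_diff[OF assms(2,1)]] by blast
  have pos: "1 / 2 ^ k < rat_value x \<longleftrightarrow> Suc (psnd x) + psnd (pfst x) * 2 ^ k < pfst (pfst x) * 2 ^ k" for x k
  proof -
    have "1 / 2 ^ k < rat_value x \<longleftrightarrow>
        real (Suc (psnd x) + psnd (pfst x) * 2 ^ k) < real (pfst (pfst x) * 2 ^ k)"
      by (simp add: rat_value_def field_simps)
    then show ?thesis
      by (simp only: of_nat_less_iff)
  qed
  show ?thesis
  proof (rule semidecidableI[of "\<lambda>p n k. 1 / 2 ^ k < rat_value (a p n k)"])
    show "decidable (\<lambda>p z. 1 / 2 ^ psnd z < rat_value (a p (pfst z) (psnd z)))"
      unfolding pos by (intro recursive_intros a)
    show "\<rho> p n < \<sigma> p n \<longleftrightarrow> (\<exists>k. 1 / 2 ^ k < rat_value (a p n k))" for p n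
    proof
      assume less: "\<rho> p n < \<sigma> p n"
      obtain k where "1 / 2 ^ k < (\<sigma> p n - \<rho> p n) / 2"
        using reals_power_lt_ex[of "(\<sigma> p n - \<rho> p n) / 2" 2] less by (auto simp: power_one_over)
      moreover have "e < v" if "e < d / 2" "\<bar>d - v\<bar> \<le> e" for e d v :: real
        using that by linarith
      ultimately have "1 / 2 ^ k < rat_value (a p n k)"
        using a(2)[of p n k] by blast
      then show "\<exists>k. 1 / 2 ^ k < rat_value (a p n k)" ..
    next
      assume "\<exists>k. 1 / 2 ^ k < rat_value (a p n k)"
      then obtain k where "1 / 2 ^ k < rat_value (a p n k)" ..
      then show "\<rho> p n < \<sigma> p n"
        using a(2)[of p n k] by linarith
    qed
  qed
qed

lemma decidable_rat_less [recursive_intros]: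
  assumes "recursive f" "recursive g"
  shows "decidable (\<lambda>p n. rat_value (f p n) < rat_value (g p n))"
proof -
  have "rat_value x < rat_value y \<longleftrightarrow>
      pfst (pfst x) * Suc (psnd y) + psnd (pfst y) * Suc (psnd x)
      < pfst (pfst y) * Suc (psnd x) + psnd (pfst x) * Suc (psnd y)" for x y
  proof -
    have "rat_value x < rat_value y \<longleftrightarrow>
        real (pfst (pfst x) * Suc (psnd y) + psnd (pfst y) * Suc (psnd x))
        < real (pfst (pfst y) * Suc (psnd x) + psnd (pfst x) * Suc (psnd y))"
      by (simp add: rat_value_def field_simps del: of_nat_Suc) (simp add: algebra_simps)
    then show ?thesis
      by (simp only: of_nat_less_iff)
  qed
  then show ?thesis
    by (simp only:) (intro recursive_intros assms)
qed

section \<open>Words and lists\<close>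

text \<open>
  In bijective base 2 the first letter of a word is the least significant digit of its code. One step
  on the pair of a code and a state splits off this letter and lets it act on the state. The code
  is an upper bound for the number of letters, and steps on the code of the empty word have no effect,
  so the code also serves as the number of iterations.
\<close>

definition word_step :: "(nat \<Rightarrow> nat \<Rightarrow> nat) \<Rightarrow> nat \<Rightarrow> nat" where
  "word_step g z = (if pfst z = 0 then z
     else pair ((pfst z - 1) div 2) (g (psnd z) (of_bool (even (pfst z)))))"

definition word_run :: "(nat \<Rightarrow> nat \<Rightarrow> nat) \<Rightarrow> nat \<Rightarrow> nat \<Rightarrow> nat" where
  "word_run g s n = psnd (rec_nat (pair n s) (\<lambda>_. word_step g) n)"

lemma word_run_eq_foldl: "word_run g s (word_code w) = foldl (\<lambda>s b. g s (of_bool b)) s w"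
proof -
  have shift: "rec_nat z (\<lambda>_. f) (Suc n) = rec_nat (f z) (\<lambda>_. f) n" for z :: nat and f n
    by (induction n) auto
  have step: "word_step g (pair (word_code (b # w)) s) = pair (word_code w) (g s (of_bool b))" for b w s
    by (auto simp: word_step_def)
  have "rec_nat (pair (word_code w) s) (\<lambda>_. word_step g) n = pair 0 (foldl (\<lambda>s b. g s (of_bool b)) s w)"
    if "length w \<le> n" for n
    using that
  proof (induction w arbitrary: s n)
    case Nil
    show ?case by (induction n) (auto simp: word_step_def)
  next
    case (Cons b w)
    then obtain m where "n = Suc m" "length w \<le> m"
      by (cases n) auto
    then show ?case
      using Cons.IH[of m "g s (of_bool b)"] shift[of _ "word_step g"] step by simp
  qed
  moreover have "length w \<le> word_code w"
    by (induction w) auto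
  ultimately show ?thesis
    by (simp add: word_run_def)
qed

lemma recursive_word_run:
  assumes "recursive (\<lambda>p z. g (pfst z) (psnd z))" "recursive f"
  shows "recursive (\<lambda>p n. word_run g s (f p n))"
proof -
  have g: "recursive (\<lambda>p n. g (h p n) (k p n))" if "recursive h" "recursive k" for h k
    using recursive_compose[OF assms(1) recursive_pair[OF that]] by simp
  show ?thesis
    unfolding word_run_def word_step_def by (intro recursive_intros g assms)
qed

lemma word_code_surj: "\<exists>w. word_code w = n"
proof (induction n rule: less_induct)
  case (less n)
  show ?case
  proof (cases "n = 0")
    case True
    then have "word_code [] = n" by simp
    then show ?thesis by blast
  next
    case False
    then have "(n - 1) div 2 < n"
      by linarith
    then obtain w where w: "word_code w = (n - 1) div 2"
      using less by blast
    have "word_code (even n # w) = n"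
      using False w by (auto elim!: evenE oddE)
    then show ?thesis by blast
  qed
qed

definition tail_code :: "nat \<Rightarrow> nat \<Rightarrow> nat" where
  "tail_code s i = rec_nat s (\<lambda>_ r. psnd (r - 1)) i"

lemma prod_decode_0: "prod_decode 0 = (0, 0)"
proof -
  have "prod_encode (0, 0) = 0"
    by (simp add: prod_encode_def)
  then show ?thesis
    using prod_encode_inverse[of "(0, 0)"] by simp
qed

lemma tail_code_eq: "tail_code s i = list_encode (drop i (list_decode s))"
proof (induction i)
  case (Suc i)
  have "psnd (list_encode xs - 1) = list_encode (tl xs)" for xs
    by (cases xs) (auto simp: prod_decode_0)
  then show ?case
    using Suc by (simp add: tail_code_def drop_Suc tl_drop)
qed (simp add: tail_code_def)

lemma recursive_tail_code [recursive_intros]: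
  "recursive f \<Longrightarrow> recursive g \<Longrightarrow> recursive (\<lambda>p n. tail_code (f p n) (g p n))"
  unfolding tail_code_def by (intro recursive_intros)

lemma length_list_decode_le: "length (list_decode s) \<le> s"
proof -
  have "length xs \<le> list_encode xs" for xs
    by (induction xs) (auto intro: order_trans[OF _ le_prod_encode_2])
  from this[of "list_decode s"] show ?thesis by simp
qed

lemma list_encode_eq_0_iff: "list_encode xs = 0 \<longleftrightarrow> xs = []"
  by (cases xs) auto

lemma recursive_length [recursive_intros]:
  assumes "recursive f" shows "recursive (\<lambda>p n. length (list_decode (f p n)))"
proof -
  have tail: "tail_code s i = 0 \<longleftrightarrow> length (list_decode s) \<le> i" for s i
    by (simp add: tail_code_eq list_encode_eq_0_iff)
  have "recursive (\<lambda>p n. LEAST i. tail_code (f p n) i = 0)"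
    by (intro recursive_intros recursive_compose[OF assms]) (auto simp: tail)
  moreover have "(LEAST i. tail_code s i = 0) = length (list_decode s)" for s
    unfolding tail by (rule Least_equality) auto
  ultimately show ?thesis by simp
qed

text \<open>
  A list is never longer than its code, so the quantifier over its entries becomes a bounded one.
\<close>

lemma Ball_list_decode:
  "(\<forall>x\<in>set (list_decode s). P x) \<longleftrightarrow>
     (\<forall>i<s. tail_code s i = 0 \<or> P (pfst (tail_code s i - 1)))"
proof -
  have "tail_code s i = 0 \<or> P (pfst (tail_code s i - 1)) \<longleftrightarrow>
      (i < length (list_decode s) \<longrightarrow> P (list_decode s ! i))" for i
  proof (cases "i < length (list_decode s)")
    case True
    have "tail_code s i = Suc (pair (list_decode s ! i) (list_encode (drop (Suc i) (list_decode s))))"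
      by (simp only: tail_code_eq Cons_nth_drop_Suc[OF True, symmetric] list_encode.simps)
    then show ?thesis using True by simp
  next
    case False
    then show ?thesis by (simp add: tail_code_eq)
  qed
  then show ?thesis
    using length_list_decode_le[of s] by (auto simp: all_set_conv_all_nth)
qed

lemma decidable_list_all [recursive_intros]:
  assumes "recursive f" "decidable (\<lambda>p z. P p (pfst z) (psnd z))"
  shows "decidable (\<lambda>p n. \<forall>x\<in>set (list_decode (f p n)). P p n x)"
  unfolding Ball_list_decode
  by (intro recursive_intros decidable_compose2[OF assms(2)] assms(1) recursive_compose[OF assms(1)])

lemma semidecidable_list_all [semidecidable_intros]:
  assumes "recursive f" "semidecidable (\<lambda>p z. P p (pfst z) (psnd z))"
  shows "semidecidable (\<lambda>p n. \<forall>x\<in>set (list_decode (f p n)). P p n x)"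
  unfolding Ball_list_decode
  by (intro semidecidable_intros decidable_imp_semidecidable recursive_intros
      semidecidable_compose2[OF assms(2)] assms(1) recursive_compose[OF assms(1)])

section \<open>Names of points and of closed sets\<close>

lemma baire_lim_eq_Some_iff:
  "baire_lim p = Some q \<longleftrightarrow> (\<forall>n. \<exists>t0. \<forall>t\<ge>t0. p (pair t n) = q n)"
proof -
  have pointwise: "component p \<longlonglongrightarrow> q \<longleftrightarrow> (\<forall>n. \<exists>t0. \<forall>t\<ge>t0. p (pair t n) = q n)" for q
  proof -
    have "component p \<longlonglongrightarrow> q \<longleftrightarrow> limitin (product_topology (\<lambda>_. euclidean) UNIV) (component p) q sequentially"
      by (simp add: euclidean_product_topology)
    also have "\<dots> \<longleftrightarrow> (\<forall>n. (\<lambda>t. component p t n) \<longlonglongrightarrow> q n)"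
      by (auto simp: limitin_componentwise)
    finally show ?thesis
      by (simp add: tendsto_discrete eventually_sequentially component_def)
  qed
  have unique: "q = q'" if "component p \<longlonglongrightarrow> q" "component p \<longlonglongrightarrow> q'" for q q'
  proof
    fix n
    obtain t0 where "\<forall>t\<ge>t0. p (pair t n) = q n"
      using \<open>component p \<longlonglongrightarrow> q\<close> unfolding pointwise by blast
    moreover obtain t1 where "\<forall>t\<ge>t1. p (pair t n) = q' n"
      using \<open>component p \<longlonglongrightarrow> q'\<close> unfolding pointwise by blast
    ultimately show "q n = q' n"
      by (metis linear)
  qed
  have "baire_lim p = Some q \<longleftrightarrow> component p \<longlonglongrightarrow> q"
  proof
    assume lim: "component p \<longlonglongrightarrow> q"
    then have "(THE q. component p \<longlonglongrightarrow> q) = q"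
      using unique by (intro the_equality) blast+
    then show "baire_lim p = Some q"
      using lim by (auto simp: baire_lim_def)
  next
    assume "baire_lim p = Some q"
    then obtain q' where "component p \<longlonglongrightarrow> q'" "q = (THE q. component p \<longlonglongrightarrow> q)"
      by (auto simp: baire_lim_def split: if_splits)
    moreover from this have "(THE q. component p \<longlonglongrightarrow> q) = q'"
      using unique by (intro the_equality) blast+
    ultimately show "component p \<longlonglongrightarrow> q"
      by simp
  qed
  then show ?thesis
    by (simp only: pointwise)
qed

lemma cauchy_repI:
  assumes "\<And>k n. k \<le> n \<Longrightarrow> d (\<alpha> (p n)) (\<alpha> (p k)) < 1 / 2 ^ k" "metric_limit d (\<alpha> \<circ> p) x"
    and "\<And>y. metric_limit d (\<alpha> \<circ> p) y \<Longrightarrow> y = x"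
  shows "cauchy_rep d \<alpha> p = Some x"
proof -
  have "(THE x. metric_limit d (\<alpha> \<circ> p) x) = x"
    using assms(2,3) by (intro the_equality)
  then show ?thesis
    using assms(1,2) unfolding cauchy_rep_def by (metis (no_types, lifting))
qed

lemma metric_limit_dist_iff: "metric_limit dist s x \<longleftrightarrow> s \<longlonglongrightarrow> x"
  unfolding metric_limit_def by (rule tendsto_dist_iff[symmetric])

lemma cauchy_rep_dist_eq_Some_iff:
  "cauchy_rep dist \<alpha> p = Some x \<longleftrightarrow>
     (\<forall>k n. k \<le> n \<longrightarrow> dist (\<alpha> (p n)) (\<alpha> (p k)) < 1 / 2 ^ k) \<and> (\<alpha> \<circ> p) \<longlonglongrightarrow> x"
proof -
  have "(THE x. (\<alpha> \<circ> p) \<longlonglongrightarrow> x) = x" if "(\<alpha> \<circ> p) \<longlonglongrightarrow> x" for x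
    using that by (blast intro: LIMSEQ_unique)
  then show ?thesis
    by (auto simp: cauchy_rep_def metric_limit_dist_iff)
qed

lemma dist_fast_limit_le:
  assumes "\<And>n. k \<le> n \<Longrightarrow> dist (s n) (s k) < e" "s \<longlonglongrightarrow> x"
  shows "dist (s k) x \<le> e"
proof (rule Lim_dist_ubound[OF _ assms(2)])
  show "\<forall>\<^sub>F n in sequentially. dist (s k) (s n) \<le> e"
    using assms(1) by (auto simp: eventually_sequentially dist_commute intro!: exI[of _ k] less_imp_le)
qed simp

lemma cauchy_rep_distD:
  assumes "cauchy_rep dist \<alpha> p = Some x" shows "dist (\<alpha> (p k)) x \<le> 1 / 2 ^ k"
  using assms dist_fast_limit_le[of k "\<alpha> \<circ> p"] by (simp add: cauchy_rep_dist_eq_Some_iff)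

text \<open>
  Members of a fast Cauchy sequence have distance less than 1 from the first one. So the first entry
  of a name already decides between \<open>\<infinity>\<close> and the points of \<open>X\<close>.
\<close>

lemma cauchy_rep_inf_cases:
  assumes "cauchy_rep dist_inf (dense_inf \<alpha>) p = Some y"
  obtains "y = Infty" "\<And>k. p k = 0"
  | x r where "y = Point x" "\<And>k. p k = Suc (r k)" "cauchy_rep dist \<alpha> r = Some x"
proof -
  have fast: "k \<le> n \<Longrightarrow> dist_inf (dense_inf \<alpha> (p n)) (dense_inf \<alpha> (p k)) < 1 / 2 ^ k" for k n
    using assms by (auto simp: cauchy_rep_def split: if_splits)
  have y: "y = (THE x. metric_limit dist_inf (dense_inf \<alpha> \<circ> p) x)"
    and ex: "\<exists>x. metric_limit dist_inf (dense_inf \<alpha> \<circ> p) x"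
    using assms by (auto simp: cauchy_rep_def split: if_splits)
  show ?thesis
  proof (cases "p 0")
    case 0
    have p: "p k = 0" for k
      using fast[of 0 k] 0 by (cases "p k") auto
    have "metric_limit dist_inf (dense_inf \<alpha> \<circ> p) z \<longleftrightarrow> z = Infty" for z
      using p by (cases z) (auto simp: metric_limit_def comp_def LIMSEQ_const_iff)
    then have "y = Infty"
      unfolding y by (intro the_equality) simp_all
    then show ?thesis
      using p that(1) by blast
  next
    case (Suc m)
    have "p k \<noteq> 0" for k
      using fast[of 0 k] Suc by (cases "p k") auto
    then have p: "p k = Suc (p k - 1)" for k
      by (metis Suc_pred' neq0_conv)
    define r where "r k = p k - 1" for k
    have p: "p k = Suc (r k)" for k
      using p unfolding r_def .
    have limit: "metric_limit dist_inf (dense_inf \<alpha> \<circ> p) z \<longleftrightarrow> (\<exists>x. z = Point x \<and> (\<alpha> \<circ> r) \<longlonglongrightarrow> x)" for z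
      using p by (cases z) (auto simp: metric_limit_def comp_def LIMSEQ_const_iff tendsto_dist_iff[of "\<lambda>n. \<alpha> (r n)"])
    then obtain x where x: "(\<alpha> \<circ> r) \<longlonglongrightarrow> x"
      using ex by auto
    have "y = Point x"
      unfolding y limit using x LIMSEQ_unique by (intro the_equality) blast+
    moreover have "cauchy_rep dist \<alpha> r = Some x"
      using x fast p by (simp add: cauchy_rep_dist_eq_Some_iff)
    ultimately show ?thesis
      using p that(2) by blast
  qed
qed

lemma cauchy_rep_inf_const:
  "cauchy_rep dist_inf (dense_inf \<alpha>) (\<lambda>_. n) = Some (dense_inf \<alpha> n)"
proof (cases n)
  case 0
  have "metric_limit dist_inf (dense_inf \<alpha> \<circ> (\<lambda>_. n)) z \<longleftrightarrow> z = Infty" for z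
    using 0 by (cases z) (auto simp: metric_limit_def comp_def LIMSEQ_const_iff)
  then show ?thesis
    using 0 by (intro cauchy_repI) auto
next
  case (Suc m)
  have "metric_limit dist_inf (dense_inf \<alpha> \<circ> (\<lambda>_. n)) z \<longleftrightarrow> z = Point (\<alpha> m)" for z
    using Suc by (cases z) (auto simp: metric_limit_def comp_def LIMSEQ_const_iff)
  then show ?thesis
    using Suc by (intro cauchy_repI) auto
qed

text \<open>
  The point \<open>\<infinity>\<close> has distance 1 from the space and does not contribute to the closure.
\<close>

lemma Point_in_metric_closure_iff:
  "Point x \<in> metric_closure dist_inf S \<longleftrightarrow> x \<in> closure {y. Point y \<in> S}"
proof
  assume x: "Point x \<in> metric_closure dist_inf S"
  show "x \<in> closure {y. Point y \<in> S}"
    unfolding closure_approachable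
  proof (intro allI impI)
    fix e :: real assume "e > 0"
    moreover have "\<forall>e>0. \<exists>s\<in>S. dist_inf s (Point x) < e"
      using x by (simp add: metric_closure_def)
    ultimately obtain s where s: "s \<in> S" "dist_inf s (Point x) < min e 1"
      by (meson min_less_iff_conj zero_less_one)
    then show "\<exists>y\<in>{y. Point y \<in> S}. dist y x < e"
      by (cases s) auto
  qed
next
  assume x: "x \<in> closure {y. Point y \<in> S}"
  show "Point x \<in> metric_closure dist_inf S"
    unfolding metric_closure_def
  proof (intro CollectI allI impI)
    fix e :: real assume "e > 0"
    then obtain y where "Point y \<in> S" "dist y x < e"
      using x unfolding closure_approachable by blast
    then show "\<exists>s\<in>S. dist_inf s (Point x) < e"
      by (intro bexI[of _ "Point y"]) auto
  qed
qed

lemma psi_plus_eq_closure: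
  assumes "psi_plus \<alpha> p = Some A"
  shows "A = closure {x. \<exists>z r. (\<forall>l. p (pair z l) = Suc (r l)) \<and> cauchy_rep dist \<alpha> r = Some x}"
proof -
  let ?\<delta> = "cauchy_rep dist_inf (dense_inf \<alpha>)"
  define s where "s = (\<lambda>z. the (?\<delta> (component p z)))"
  have dom: "\<And>z. component p z \<in> dom ?\<delta>"
    and A: "A = {x. Point x \<in> metric_closure dist_inf (range s)}"
    using assms by (auto simp: psi_plus_def seq_rep_def s_def split: if_splits)
  have s: "?\<delta> (component p z) = Some (s z)" for z
    using dom[of z] by (auto simp: s_def)
  have "Point x \<in> range s \<longleftrightarrow> (\<exists>z r. (\<forall>l. p (pair z l) = Suc (r l)) \<and> cauchy_rep dist \<alpha> r = Some x)" for x
  proof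
    assume "Point x \<in> range s"
    then obtain z where z: "s z = Point x"
      by auto
    from s[of z] show "\<exists>z r. (\<forall>l. p (pair z l) = Suc (r l)) \<and> cauchy_rep dist \<alpha> r = Some x"
      by (cases rule: cauchy_rep_inf_cases) (use z in \<open>auto simp: component_def\<close>)
  next
    assume "\<exists>z r. (\<forall>l. p (pair z l) = Suc (r l)) \<and> cauchy_rep dist \<alpha> r = Some x"
    then obtain z r where r: "\<And>l. p (pair z l) = Suc (r l)" "cauchy_rep dist \<alpha> r = Some x"
      by blast
    from s[of z] have "s z = Point x"
    proof (cases rule: cauchy_rep_inf_cases)
      case 1
      then show ?thesis using r(1) by (auto simp: component_def)
    next
      case (2 x' r')
      then have "r' = r"
        using r(1) by (auto simp: component_def)
      then show ?thesis using 2 r(2) by simp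
    qed
    then show "Point x \<in> range s"
      by (metis rangeI)
  qed
  then show ?thesis
    unfolding A Point_in_metric_closure_iff by simp
qed

text \<open>
  The simplest names: each element of the dense sequence is named by a constant sequence, and the
  constant 0, which names \<open>\<infinity>\<close>, lists nothing.
\<close>

lemma psi_plus_constant_names:
  assumes "\<And>z l. p (pair z l) = c z"
  shows "psi_plus \<alpha> p = Some (closure {\<alpha> m | m z. c z = Suc m})"
proof -
  have comp: "component p z = (\<lambda>_. c z)" for z
    using assms by (auto simp: component_def)
  have "{y. Point y \<in> range (\<lambda>z. dense_inf \<alpha> (c z))} = {\<alpha> m | m z. c z = Suc m}"
  proof (intro set_eqI iffI)
    fix y assume "y \<in> {y. Point y \<in> range (\<lambda>z. dense_inf \<alpha> (c z))}"
    then obtain z where "dense_inf \<alpha> (c z) = Point y"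
      by auto
    then show "y \<in> {\<alpha> m | m z. c z = Suc m}"
      by (cases "c z") auto
  next
    fix y assume "y \<in> {\<alpha> m | m z. c z = Suc m}"
    then obtain m z where "y = \<alpha> m" "c z = Suc m"
      by blast
    then have "Point y = dense_inf \<alpha> (c z)"
      by simp
    then show "y \<in> {y. Point y \<in> range (\<lambda>z. dense_inf \<alpha> (c z))}"
      by blast
  qed
  then show ?thesis
    by (simp add: psi_plus_def seq_rep_def comp cauchy_rep_inf_const dom_def Point_in_metric_closure_iff)
qed

lemma basic_ball_eq: "basic_ball \<alpha> b = ball (\<alpha> (pfst b)) (rat_value (psnd b))"
  by (simp add: basic_ball_def case_prod_beta real_of_rat_enum)

lemma seq_rep_psi_minus:
  "seq_rep (psi_minus \<alpha>) p = Some (\<lambda>i. UNIV - (\<Union>j. basic_ball \<alpha> (p (pair i j))))"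
  by (simp add: seq_rep_def psi_minus_def component_def dom_def)

section \<open>Effective perfect Polish spaces\<close>

locale effective_perfect_polish =
  fixes \<alpha> :: "nat \<Rightarrow> 'a::{polish_space, perfect_space}"
  assumes computable_polish: "computable_polish \<alpha>"
begin

lemma open_meets_dense_sequence:
  assumes "open U" "x \<in> U" "finite F"
  shows "\<exists>m. \<alpha> m \<in> U \<and> \<alpha> m \<notin> F"
proof -
  have "infinite (U \<inter> UNIV)"
    using islimpt_UNIV[of x] assms(1,2) unfolding islimpt_eq_acc_point by blast
  then have "U - F \<noteq> {}"
    using assms(3) finite_subset by auto
  moreover have "open (U - F)"
    using assms(1,3) by (simp add: open_Diff finite_imp_closed)
  moreover have "closure (range \<alpha>) = UNIV"
    using computable_polish by (simp add: computable_polish_def)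
  ultimately have "(U - F) \<inter> range \<alpha> \<noteq> {}"
    using open_Int_closure_eq_empty[of "U - F" "range \<alpha>"] by auto
  then show ?thesis by auto
qed

lemma open_contains_basic_ball:
  assumes "open U" "x \<in> U"
  shows "\<exists>m r. dist (\<alpha> m) x < rat_value r \<and> ball (\<alpha> m) (rat_value r) \<subseteq> U"
proof -
  obtain e where e: "e > 0" "ball x e \<subseteq> U"
    using assms openE by blast
  obtain m where m: "dist (\<alpha> m) x < e / 3"
    using open_meets_dense_sequence[of "ball x (e / 3)" x "{}"] e(1) by (auto simp: dist_commute)
  obtain r where r: "dist (\<alpha> m) x < rat_value r" "rat_value r < e / 3"
    using rat_value_between[OF m] by blast
  have "0 < rat_value r"
    using r(1) zero_le_dist[of "\<alpha> m" x] by linarith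
  have "ball (\<alpha> m) (rat_value r) \<subseteq> ball x e"
  proof
    fix y assume "y \<in> ball (\<alpha> m) (rat_value r)"
    then show "y \<in> ball x e"
      using r dist_triangle[of x y "\<alpha> m"] \<open>0 < rat_value r\<close> by (simp add: dist_commute)
  qed
  with r e show ?thesis by blast
qed

lemma computable_real_dist [computable_real_intros]:
  assumes "recursive f" "recursive g"
  shows "computable_real (\<lambda>p n. dist (\<alpha> (f p n)) (\<alpha> (g p n)))"
proof -
  obtain r where r: "computable_nat r"
    "\<And>i j. cauchy_rep dist (\<lambda>k. real_of_rat (rat_enum k)) (\<lambda>k. r (pair (pair i j) k)) = Some (dist (\<alpha> i) (\<alpha> j))"
    using computable_polish unfolding computable_polish_def by blast
  obtain \<Phi> where "partial_recursive \<Phi>" "\<And>p n. \<Phi> p n = Some (r n)"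
    using r(1) unfolding computable_nat_def by blast
  moreover from this have "\<Phi> = (\<lambda>p n. Some (r n))"
    by blast
  ultimately have "recursive (\<lambda>p. r)"
    by (simp add: recursive_def)
  then have "recursive (\<lambda>p z. r (pair (pair (f p (pfst z)) (g p (pfst z))) (psnd z)))"
    by (rule recursive_compose) (intro recursive_intros recursive_compose[OF assms(1)] recursive_compose[OF assms(2)])
  then show ?thesis
  proof (rule computable_realI)
    fix p n k
    show "\<bar>dist (\<alpha> (f p n)) (\<alpha> (g p n)) - rat_value (r (pair (pair (f p n) (g p n)) k))\<bar> \<le> 1 / 2 ^ k"
      using cauchy_rep_distD[OF r(2)[of "f p n" "g p n"], of k]
      by (simp add: real_of_rat_enum dist_real_def abs_minus_commute)
  qed
qed

section \<open>Negative information in the limit yields positive information\<close>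

text \<open>
  Let \<open>U\<close> be the complement of \<open>A\<^sub>i\<close>, a union of balls whose indices are known in the limit only. For
  every ball \<open>b\<close> and arbitrarily large \<open>k\<close>, one element of the dense sequence is listed that lies in \<open>b\<close>
  and, by the approximation at some stage \<open>t \<ge> k\<close>, at distance more than \<open>r - 1 / 2 ^ k\<close> from the centre of
  each of the first \<open>k + 1\<close> balls of \<open>U\<close>, where \<open>r\<close> is the radius. Let \<open>D\<close> be the set of listed points.
  
  If \<open>x \<notin> U\<close> and \<open>x \<in> b\<close>, then a listed point exists for \<open>b\<close> and every \<open>k\<close>: a stage at which the
  first \<open>k + 1\<close> indices are final and a point near \<open>x\<close> satisfy all requirements. So \<open>x\<close> is in the closure
  of \<open>D\<close>. If \<open>y \<in> U\<close>, then \<open>y\<close> is in some ball of \<open>U\<close>, whose index is final from some stage on. For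
  large \<open>k\<close> the listed points are nearly outside this ball, hence at a positive distance from \<open>y\<close>. So \<open>D\<close> is locally finite in
  \<open>U\<close>, and in a perfect space the closure of \<open>D\<close> is nowhere dense if \<open>U\<close> is dense. Every point outside
  the closure of \<open>D\<close> is outside \<open>A\<^sub>i\<close>, so the solution is passed on unchanged.
\<close>

lemma jump_BCT0_le_BCT2: "jump (BCT0 \<alpha>) \<le>\<^sub>s\<^sub>W BCT2 \<alpha>"
proof -
  \<comment> \<open>Here \<open>n = \<langle>i, k\<rangle>\<close>, where the first component of \<open>k\<close> is the ball \<open>b\<close>, and \<open>v = \<langle>m, t\<rangle>\<close>.\<close>
  define S where "S p n v \<longleftrightarrow>
      psnd n \<le> psnd v \<and>
      dist (\<alpha> (pfst v)) (\<alpha> (pfst (pfst (psnd n)))) < rat_value (psnd (pfst (psnd n))) \<and>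
      (\<forall>a<Suc (psnd n). rat_value (psnd (p (pair (psnd v) (pair (pfst n) a)))) - 1 / 2 ^ psnd n
         < dist (\<alpha> (pfst v)) (\<alpha> (pfst (p (pair (psnd v) (pair (pfst n) a))))))" for p n v
  have "semidecidable (\<lambda>p z. S p (pfst z) (psnd z))"
    unfolding S_def
    by (intro semidecidable_intros computable_real_intros recursive_intros
        decidable_imp_semidecidable[OF decidable_le])
  then obtain T where T: "decidable (\<lambda>p z. T p (pfst z) (psnd z))"
    "\<And>p n u. T p n u \<Longrightarrow> S p n (pfst u)"
    "\<And>p n u v. T p n u \<Longrightarrow> T p n v \<Longrightarrow> u = v"
    "\<And>p n v. S p n v \<Longrightarrow> \<exists>u. T p n u"
    by (rule semidecidable_uniformization[where S = S]) blast
  define K where "K p n = (let i = pfst n; z = pfst (psnd n) in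
      if T p (pair i (pfst z)) (psnd z) then Suc (pfst (pfst (psnd z))) else 0)" for p n
  have K: "recursive K"
    unfolding K_def Let_def by (intro recursive_intros decidable_compose2[OF T(1)])
  define D where "D p i = {\<alpha> (pfst (pfst u)) | k u. T p (pair i k) u}" for p i
  have psi: "psi_plus \<alpha> (component (K p) i) = Some (closure (D p i))" for p i
  proof -
    define c where "c z = (if T p (pair i (pfst z)) (psnd z) then Suc (pfst (pfst (psnd z))) else 0)" for z
    have "component (K p) i (pair z l) = c z" for z l
      by (simp add: component_def K_def c_def)
    from psi_plus_constant_names[of "component (K p) i" c, OF this]
    have "psi_plus \<alpha> (component (K p) i) = Some (closure {\<alpha> m | m z. c z = Suc m})" .
    moreover have "{\<alpha> m | m z. c z = Suc m} = D p i"
    proof (intro set_eqI iffI)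
      fix y assume "y \<in> D p i"
      then obtain k u where u: "y = \<alpha> (pfst (pfst u))" "T p (pair i k) u"
        unfolding D_def by blast
      then have "c (pair k u) = Suc (pfst (pfst u))"
        by (simp add: c_def)
      then show "y \<in> {\<alpha> m | m z. c z = Suc m}"
        using u(1) by blast
    qed (auto simp: c_def D_def split: if_splits)
    ultimately show ?thesis by simp
  qed
  have input: "(\<forall>i. A i \<subseteq> closure (D p i)) \<and> (\<forall>i. interior (closure (D p i)) = {})"
    if q: "baire_lim p = Some q" and A: "A = (\<lambda>i. UNIV - (\<Union>j. basic_ball \<alpha> (q (pair i j))))"
      and empty: "\<And>i. interior (A i) = {}" for p q A
  proof -
    have stable: "\<exists>t0. \<forall>t\<ge>t0. p (pair t n) = q n" for n
      using q unfolding baire_lim_eq_Some_iff by blast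
    have "x \<in> closure (D p i)" if x: "x \<in> A i" for x i
      unfolding closure_approachable
    proof (intro allI impI)
      fix e :: real assume "e > 0"
      then obtain m r where m: "dist (\<alpha> m) x < rat_value r" "ball (\<alpha> m) (rat_value r) \<subseteq> ball x e"
        using open_contains_basic_ball[of "ball x e" x] by auto
      define k where "k = pair (pair m r) 0"
      have "\<forall>a. \<exists>t0. \<forall>t\<ge>t0. p (pair t (pair i a)) = q (pair i a)"
        using stable by blast
      from choice[OF this] obtain g where g: "\<And>a t. t \<ge> g a \<Longrightarrow> p (pair t (pair i a)) = q (pair i a)"
        by blast
      define t where "t = Max (insert k (g ` {..k}))"
      have t: "k \<le> t" "\<And>a. a < Suc k \<Longrightarrow> p (pair t (pair i a)) = q (pair i a)"
        by (auto simp: t_def intro!: g Max_ge simp del: Max_insert)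
      define U where "U = ball (\<alpha> m) (rat_value r) \<inter>
        (\<Inter>a\<in>{..k}. {y. rat_value (psnd (q (pair i a))) - 1 / 2 ^ k < dist y (\<alpha> (pfst (q (pair i a))))})"
      have "open {y. c < dist y z}" for c :: real and z :: 'a
        by (intro open_Collect_less continuous_intros)
      then have "open U"
        unfolding U_def by (intro open_Int open_INT) auto
      moreover have "x \<in> U"
      proof -
        have "rat_value (psnd (q (pair i a))) \<le> dist x (\<alpha> (pfst (q (pair i a))))" for a
          using x by (auto simp: A basic_ball_eq dist_commute not_less)
        then have "rat_value (psnd (q (pair i a))) - 1 / 2 ^ k < dist x (\<alpha> (pfst (q (pair i a))))" for a
          by (rule less_le_trans[rotated]) simp
        then show ?thesis
          using m(1) by (simp add: U_def)
      qed
      ultimately obtain l where l: "\<alpha> l \<in> U"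
        using open_meets_dense_sequence[of U x "{}"] by blast
      then have "S p (pair i k) (pair l t)"
        using t by (auto simp: S_def U_def k_def dist_commute)
      then obtain u where u: "T p (pair i k) u"
        using T(4) by blast
      from T(2)[OF this] have "\<alpha> (pfst (pfst u)) \<in> ball (\<alpha> m) (rat_value r)"
        by (simp add: S_def k_def dist_commute)
      then have "\<alpha> (pfst (pfst u)) \<in> ball x e"
        using m(2) by blast
      then have "dist (\<alpha> (pfst (pfst u))) x < e"
        by (simp add: dist_commute)
      with u show "\<exists>y\<in>D p i. dist y x < e"
        by (auto simp: D_def)
    qed
    moreover have "interior (closure (D p i)) = {}" for i
    proof (rule ccontr)
      assume "interior (closure (D p i)) \<noteq> {}"
      then have "\<not> interior (closure (D p i)) \<subseteq> A i"
        using empty[of i] interior_maximal[OF _ open_interior] by blast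
      then obtain y j where y: "y \<in> interior (closure (D p i))" "y \<in> basic_ball \<alpha> (q (pair i j))"
        by (auto simp: A)
      define c where "c = \<alpha> (pfst (q (pair i j)))"
      define r where "r = rat_value (psnd (q (pair i j)))"
      define e where "e = (r - dist y c) / 2"
      have "e > 0"
        using y(2) by (simp add: e_def c_def r_def basic_ball_eq dist_commute)
      obtain t0 where t0: "\<And>t. t \<ge> t0 \<Longrightarrow> p (pair t (pair i j)) = q (pair i j)"
        using stable by blast
      obtain k0 where k0: "1 / 2 ^ k0 < e"
        using reals_power_lt_ex[of e 2] \<open>e > 0\<close> by (auto simp: power_one_over)
      define k1 where "k1 = Max {j, t0, k0}"
      define F where "F = (\<lambda>u. \<alpha> (pfst (pfst u))) ` (\<Union>k<k1. {u. T p (pair i k) u})"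
      have "finite {u. T p (pair i k) u}" for k
      proof (cases "\<exists>u. T p (pair i k) u")
        case True
        then obtain u where "T p (pair i k) u" ..
        then have "{u. T p (pair i k) u} \<subseteq> {u}"
          using T(3) by blast
        then show ?thesis
          using finite_subset by blast
      qed simp
      then have "finite F"
        by (simp add: F_def)
      have far: "D p i \<inter> ball y e \<subseteq> F"
      proof
        fix z assume z: "z \<in> D p i \<inter> ball y e"
        then obtain k u where u: "z = \<alpha> (pfst (pfst u))" "T p (pair i k) u"
          by (auto simp: D_def)
        have "k < k1"
        proof (rule ccontr)
          assume "\<not> k < k1"
          then have k: "j \<le> k" "t0 \<le> k" "k0 \<le> k"
            by (auto simp: k1_def)
          have S: "S p (pair i k) (pfst u)"
            using T(2)[OF u(2)] .
          then have "p (pair (psnd (pfst u)) (pair i j)) = q (pair i j)"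
            using k(2) by (intro t0) (simp add: S_def)
          with S k(1) have "r - 1 / 2 ^ k < dist z c"
            unfolding S_def r_def c_def u(1) by (metis fst_conv le_imp_less_Suc prod_encode_inverse snd_conv)
          moreover have "1 / 2 ^ k \<le> (1 / 2 ^ k0 :: real)"
            using k(3) by (simp add: frac_le)
          moreover have "r = dist y c + 2 * e"
            by (simp add: e_def field_simps)
          ultimately have "dist z c > dist y c + e"
            using k0 by linarith
          then show False
            using z dist_triangle[of z c y] by (auto simp: dist_commute)
        qed
        then show "z \<in> F"
          using u by (auto simp: F_def)
      qed
      \<comment> \<open>The closure of \<open>D\<close> contains the open set \<open>V\<close>, but \<open>D\<close> itself does not meet it.\<close>
      define V where "V = interior (closure (D p i)) \<inter> ball y e - F"
      have "open V"
        using \<open>finite F\<close> by (auto simp: V_def intro!: open_Diff finite_imp_closed)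
      obtain m where m: "\<alpha> m \<in> interior (closure (D p i)) \<inter> ball y e" "\<alpha> m \<notin> F"
        using open_meets_dense_sequence[of "interior (closure (D p i)) \<inter> ball y e" y F]
          y(1) \<open>e > 0\<close> \<open>finite F\<close> by auto
      then have "\<alpha> m \<in> V" "\<alpha> m \<in> closure (D p i)"
        using interior_subset[of "closure (D p i)"] by (auto simp: V_def)
      then have "V \<inter> D p i \<noteq> {}"
        using open_Int_closure_eq_empty[OF \<open>open V\<close>, of "D p i"] by blast
      then show False
        using far by (auto simp: V_def)
    qed
    ultimately show ?thesis by blast
  qed
  show ?thesis
  proof (rule sW_reducibleI[OF K])
    show "partial_recursive (\<lambda>q n. Some (q n))"
      by (rule partial_recursive.oracle_query)
    fix p A
    assume "in_rep (jump (BCT0 \<alpha>)) p = Some A" and dom: "A \<in> mv_dom (multi (jump (BCT0 \<alpha>)))"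
    then obtain q where q: "baire_lim p = Some q" "seq_rep (psi_minus \<alpha>) q = Some A"
      by (auto simp: jump_def BCT0_def map_comp_def split: option.splits)
    then have A: "A = (\<lambda>i. UNIV - (\<Union>j. basic_ball \<alpha> (q (pair i j))))"
      by (simp add: seq_rep_psi_minus)
    have A': "\<forall>i. closed (A i) \<and> interior (A i) = {}"
      using dom by (simp add: jump_def BCT0_def mv_dom_bct)
    define B where "B = (\<lambda>i. closure (D p i))"
    have B: "\<forall>i. A i \<subseteq> B i" "\<forall>i. closed (B i) \<and> interior (B i) = {}"
      using input[OF q(1) A] A' by (auto simp: B_def)
    have "in_rep (BCT2 \<alpha>) (K p) = Some B"
      by (simp add: BCT2_def seq_rep_def psi dom_def B_def)
    moreover have "B \<in> mv_dom (multi (BCT2 \<alpha>))"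
      using B(2) by (simp add: BCT2_def mv_dom_bct)
    moreover have "x \<in> bct A" if "x \<in> bct B" for x
    proof -
      have "x \<notin> B i" for i
        using that B(2) by (simp add: bct_def)
      then have "x \<notin> A i" for i
        using B(1) by blast
      then show ?thesis
        using A' by (simp add: bct_def)
    qed
    ultimately show "\<exists>u. in_rep (BCT2 \<alpha>) (K p) = Some u \<and> u \<in> mv_dom (multi (BCT2 \<alpha>)) \<and>
        (\<forall>q y. out_rep (BCT2 \<alpha>) q = Some y \<and> y \<in> multi (BCT2 \<alpha>) u \<longrightarrow>
          (\<exists>r z. (\<forall>n. Some (q n) = Some (r n)) \<and> out_rep (jump (BCT0 \<alpha>)) r = Some z \<and>
             z \<in> multi (jump (BCT0 \<alpha>)) A))"
      by (intro exI[of _ B]) (auto simp: jump_def BCT0_def BCT2_def)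
  qed
qed

end

section \<open>Dense sets of words\<close>

lemma mem_cylinder_iff: "x \<in> cylinder w \<longleftrightarrow> map x [0..<length w] = w"
  unfolding cylinder_def mem_Collect_eq list_eq_iff_nth_eq by simp

lemma cylinder_append_subset: "cylinder (w @ u) \<subseteq> cylinder w"
  by (auto simp: cylinder_def nth_append)

lemma cylinder_nonempty: "cylinder w \<noteq> {}"
proof -
  have "(\<lambda>i. w ! i) \<in> cylinder w"
    by (simp add: cylinder_def)
  then show ?thesis by blast
qed

lemma open_cylinder: "open (cylinder w)"
proof -
  have "open ((\<lambda>x. x i) -` {w ! i})" for i
    by (intro open_vimage open_discrete continuous_on_product_coordinates)
  then have "open (\<Inter>i\<in>{..<length w}. (\<lambda>x. x i) -` {w ! i})"
    by (intro open_INT) auto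
  moreover have "cylinder w = (\<Inter>i\<in>{..<length w}. (\<lambda>x. x i) -` {w ! i})"
    by (auto simp: cylinder_def)
  ultimately show ?thesis by simp
qed

lemma open_contains_cylinder:
  assumes "open U" "y \<in> U"
  shows "\<exists>t. cylinder (map y [0..<t]) \<subseteq> U"
proof -
  have "openin (product_topology (\<lambda>_. euclidean) UNIV) U"
    using assms(1) by (simp add: open_fun_def)
  from product_topology_open_contains_basis[OF this assms(2)]
  obtain X where X: "y \<in> Pi\<^sub>E UNIV X" "finite {i. X i \<noteq> UNIV}" "Pi\<^sub>E UNIV X \<subseteq> U"
    by auto
  obtain t where t: "\<And>i. X i \<noteq> UNIV \<Longrightarrow> i < t"
    using finite_nat_bounded[OF X(2)] by (auto simp: subset_iff)
  have "cylinder (map y [0..<t]) \<subseteq> Pi\<^sub>E UNIV X"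
  proof
    fix x assume x: "x \<in> cylinder (map y [0..<t])"
    have "x i \<in> X i" for i
    proof (cases "X i = UNIV")
      case False
      then have "x i = y i"
        using x t by (simp add: cylinder_def)
      then show ?thesis using X(1) by (simp add: PiE_iff)
    qed simp
    then show "x \<in> Pi\<^sub>E UNIV X" by (simp add: PiE_iff)
  qed
  with X(3) show ?thesis by blast
qed

lemma mem_psi_minus_words_iff: "w \<in> psi_minus_words p \<longleftrightarrow> (\<forall>i. p i \<noteq> Suc (word_code w))"
  by (auto simp: psi_minus_words_def)

lemma closed_complement_of_cylinders: "closed (UNIV - (\<Union>w\<in>E. cylinder w))"
  using open_cylinder by (auto simp: Compl_eq_Diff_UNIV[symmetric] closed_Compl intro!: closed_Compl)

text \<open>
  Every nonempty open set contains a cylinder, which then contains the smaller cylinder of a word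
  in \<open>E\<close>.
\<close>

lemma dense_words_interior_empty:
  assumes "\<And>w. \<exists>u. w @ u \<in> E"
  shows "interior (UNIV - (\<Union>w\<in>E. cylinder w)) = {}"
proof (rule ccontr)
  assume "interior (UNIV - (\<Union>w\<in>E. cylinder w)) \<noteq> {}"
  then obtain y where "y \<in> interior (UNIV - (\<Union>w\<in>E. cylinder w))"
    by blast
  from open_contains_cylinder[OF open_interior this]
  obtain w where w: "cylinder w \<subseteq> interior (UNIV - (\<Union>w\<in>E. cylinder w))"
    by blast
  obtain u where "w @ u \<in> E"
    using assms by blast
  moreover have "cylinder (w @ u) \<subseteq> UNIV - (\<Union>w\<in>E. cylinder w)"
    using w interior_subset cylinder_append_subset by (metis subset_trans)
  ultimately show False
    using cylinder_nonempty[of "w @ u"] by blast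
qed

lemma interior_empty_meets_cylinder:
  assumes "interior (UNIV - (\<Union>w\<in>E. cylinder w)) = {}"
  shows "\<exists>v\<in>E. cylinder v \<inter> cylinder w \<noteq> {}"
proof (rule ccontr)
  assume "\<not> ?thesis"
  then have "cylinder w \<subseteq> UNIV - (\<Union>w\<in>E. cylinder w)"
    by blast
  then have "cylinder w \<subseteq> interior (UNIV - (\<Union>w\<in>E. cylinder w))"
    by (rule interior_maximal[OF _ open_cylinder])
  then show False
    using assms cylinder_nonempty by blast
qed

lemma seq_rep_psi_sharp:
  "seq_rep psi_sharp p =
     Some (\<lambda>i. UNIV - (\<Union>w\<in>psi_minus_words (component p i). cylinder w))"
  by (simp add: seq_rep_def psi_sharp_def dom_def)

lemma cantor_rep_eq_SomeD:
  assumes "cantor_rep q = Some y"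
  shows "q n = of_bool (y n)"
proof -
  have "q n \<in> {0, 1}" "y = (\<lambda>n. q n = 1)"
    using assms by (auto simp: cantor_rep_def split: if_splits)
  then show ?thesis by auto
qed

section \<open>From a generic sequence to a generic point\<close>

context effective_perfect_polish
begin

text \<open>
  A number \<open>\<langle>c, k\<rangle>\<close> stands for the ball with centre \<open>\<alpha> c\<close> and radius \<open>1 / 2 ^ k\<close>. The relation is a
  semidecidable condition by which the closure of the second ball is contained in the first.
\<close>

definition inside :: "nat \<Rightarrow> nat \<Rightarrow> bool" where
  "inside b b' \<longleftrightarrow> psnd b < psnd b' \<and>
     dist (\<alpha> (pfst b)) (\<alpha> (pfst b')) + 1 / 2 ^ psnd b' < 1 / 2 ^ psnd b"

text \<open>
  Binary sequences are programs for shrinking a ball. The state is \<open>\<langle>b, \<langle>v, n\<rangle>\<rangle>\<close>: the current ball \<open>b\<close>,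
  the number \<open>v\<close> of zeros since the last one, and the number \<open>n\<close> of ones. A one executes the
  instruction \<open>v = \<langle>b', u\<rangle>\<close> to move to \<open>b'\<close>, if \<open>u\<close> witnesses that \<open>b'\<close> is inside \<open>b\<close>; otherwise it halves
  the radius. Thus any sequence with infinitely many ones determines a point.
\<close>

definition ball_step :: "(nat \<Rightarrow> nat \<Rightarrow> bool) \<Rightarrow> nat \<Rightarrow> nat \<Rightarrow> nat" where
  "ball_step R s d =
     (let b = pfst s; v = pfst (psnd s); r = psnd (psnd s) in
      if d = 0 then pair b (pair (Suc v) r)
      else pair (if R (pair b (pfst v)) (psnd v) then pfst v else pair (pfst b) (Suc (psnd b)))
             (pair 0 (Suc r)))"

definition ball_run :: "(nat \<Rightarrow> nat \<Rightarrow> bool) \<Rightarrow> bool list \<Rightarrow> nat" where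
  "ball_run R w = foldl (\<lambda>s b. ball_step R s (of_bool b)) (pair (pair 0 0) (pair 0 0)) w"

lemma semidecidable_inside: "semidecidable (\<lambda>p n. inside (pfst n) (psnd n))"
  unfolding inside_def
  by (intro semidecidable_intros computable_real_intros recursive_intros
      decidable_imp_semidecidable[OF decidable_less])

lemma inside_trans: "inside a b \<Longrightarrow> inside b c \<Longrightarrow> inside a c"
  using dist_triangle[of "\<alpha> (pfst a)" "\<alpha> (pfst c)" "\<alpha> (pfst b)"] by (auto simp: inside_def)

lemma inside_refine: "inside b (pair (pfst b) (Suc (psnd b)))"
  by (simp add: inside_def field_simps)

lemma ball_run_snoc: "ball_run R (w @ [b]) = ball_step R (ball_run R w) (of_bool b)"
  by (simp add: ball_run_def)

context
  fixes R :: "nat \<Rightarrow> nat \<Rightarrow> bool"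
  assumes R: "\<And>n. inside (pfst n) (psnd n) \<longleftrightarrow> (\<exists>u. R n u)"
begin

lemma ball_step_cases:
  "pfst (ball_step R s b) = pfst s \<and> psnd (psnd (ball_step R s b)) = psnd (psnd s) \<or>
   inside (pfst s) (pfst (ball_step R s b)) \<and> psnd (psnd (ball_step R s b)) = Suc (psnd (psnd s))"
proof -
  have "inside b (if R (pair b b') u then b' else pair (pfst b) (Suc (psnd b)))" for b b' u
    using R[of "pair b b'"] inside_refine[of b] by auto
  then show ?thesis
    by (simp add: ball_step_def Let_def)
qed

text \<open>
  The balls of a run are nested, and strictly so whenever a further digit 1 has been read.
\<close>

lemma ball_run_append:
  "pfst (ball_run R (w @ u)) = pfst (ball_run R w) \<and>
     psnd (psnd (ball_run R (w @ u))) = psnd (psnd (ball_run R w)) \<or>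
   inside (pfst (ball_run R w)) (pfst (ball_run R (w @ u))) \<and>
     psnd (psnd (ball_run R w)) < psnd (psnd (ball_run R (w @ u)))"
proof (induction u rule: rev_induct)
  case (snoc b u)
  have eq: "ball_run R (w @ u @ [b]) = ball_step R (ball_run R (w @ u)) (of_bool b)"
    using ball_run_snoc[of R "w @ u" b] by simp
  with ball_step_cases[of "ball_run R (w @ u)" "of_bool b"] show ?case
  proof (elim disjE conjE)
    assume "pfst (ball_step R (ball_run R (w @ u)) (of_bool b)) = pfst (ball_run R (w @ u))"
      "psnd (psnd (ball_step R (ball_run R (w @ u)) (of_bool b))) = psnd (psnd (ball_run R (w @ u)))"
    with eq snoc show ?thesis by simp
  next
    assume i: "inside (pfst (ball_run R (w @ u))) (pfst (ball_step R (ball_run R (w @ u)) (of_bool b)))"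
      "psnd (psnd (ball_step R (ball_run R (w @ u)) (of_bool b))) = Suc (psnd (psnd (ball_run R (w @ u))))"
    from snoc have "inside (pfst (ball_run R w)) (pfst (ball_run R (w @ u @ [b])))"
      using i(1) inside_trans[OF _ i(1)] by (elim disjE conjE) (simp_all add: eq)
    moreover from snoc have "psnd (psnd (ball_run R w)) \<le> psnd (psnd (ball_run R (w @ u)))"
      by auto
    ultimately show ?thesis
      using i(2) by (simp add: eq)
  qed
qed simp

lemma ball_run_count_le: "psnd (psnd (ball_run R w)) \<le> psnd (pfst (ball_run R w))"
proof (induction w rule: rev_induct)
  case Nil
  show ?case by (simp add: ball_run_def)
next
  case (snoc b w)
  then show ?case
    using ball_step_cases[of "ball_run R w" "of_bool b"] by (auto simp: ball_run_snoc inside_def)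
qed

lemma ball_run_block:
  assumes "ball_run R w = pair b (pair 0 r)"
  shows "ball_run R (w @ replicate v False) = pair b (pair v r)"
proof (induction v)
  case (Suc v)
  have "w @ replicate (Suc v) False = (w @ replicate v False) @ [False]"
    by (simp add: replicate_append_same)
  then show ?case
    using Suc by (simp only: ball_run_snoc) (simp add: ball_step_def)
qed (use assms in simp)

text \<open>
  The word \<open>1 0\<^sup>v 1\<close> does it: the first digit 1 clears the counter, and \<open>v\<close> codes the ball \<open>b\<close> with a
  witness.
\<close>

lemma ball_run_jump:
  assumes "inside (pfst (ball_run R (w @ [True]))) b"
  shows "\<exists>u. pfst (ball_run R (w @ u)) = b \<and> psnd (psnd (ball_run R w)) < psnd (psnd (ball_run R (w @ u)))"
proof -
  let ?a = "pfst (ball_run R (w @ [True]))" and ?r = "psnd (psnd (ball_run R (w @ [True])))"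
  obtain x where x: "R (pair ?a b) x"
    using R[of "pair ?a b"] assms by auto
  have "ball_run R (w @ [True]) = pair ?a (pair 0 ?r)"
    by (simp add: ball_run_snoc ball_step_def Let_def)
  from ball_run_block[OF this, of "pair b x"]
  have "ball_run R ((w @ [True]) @ replicate (pair b x) False) = pair ?a (pair (pair b x) ?r)" .
  then have "ball_run R (((w @ [True]) @ replicate (pair b x) False) @ [True]) = pair b (pair 0 (Suc ?r))"
    using x by (simp only: ball_run_snoc) (simp add: ball_step_def)
  moreover have "?r = Suc (psnd (psnd (ball_run R w)))"
    by (simp add: ball_run_snoc ball_step_def Let_def)
  ultimately show ?thesis
    by (intro exI[of _ "[True] @ replicate (pair b x) False @ [True]"]) simp
qed

text \<open>
  The centre for precision \<open>n\<close> may be taken at any time after \<open>n + 1\<close> ones: it lies in the first ball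
  reached after \<open>n + 1\<close> ones, whose radius is at most \<open>1 / 2 ^ (n + 1)\<close>, so any two such centres are
  close enough for a name. The limit lies in each open ball of the run, because the closures of later
  balls are contained in it.
\<close>

lemma ball_run_limit:
  fixes y :: "nat \<Rightarrow> bool" and v :: "nat \<Rightarrow> nat"
  defines "s \<equiv> \<lambda>t. ball_run R (map y [0..<t])"
  assumes v: "\<And>n. \<exists>t. v n = pfst (pfst (s t)) \<and> Suc n \<le> psnd (psnd (s t))"
  shows "\<exists>x. cauchy_rep dist \<alpha> v = Some x \<and>
    (\<forall>t. dist (\<alpha> (pfst (pfst (s t)))) x < 1 / 2 ^ psnd (pfst (s t)))"
proof -
  have mono: "pfst (s t') = pfst (s t) \<and> psnd (psnd (s t')) = psnd (psnd (s t)) \<or>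
      inside (pfst (s t)) (pfst (s t')) \<and> psnd (psnd (s t)) < psnd (psnd (s t'))" if "t \<le> t'" for t t'
  proof -
    have "map y [0..<t'] = map y [0..<t] @ map y [t..<t']"
      using upt_add_eq_append[of 0 t "t' - t"] that by simp
    then show ?thesis
      unfolding s_def using ball_run_append[of "map y [0..<t]" "map y [t..<t']"] by simp
  qed
  obtain h where h: "\<And>n. v n = pfst (pfst (s (h n)))" "\<And>n. Suc n \<le> psnd (psnd (s (h n)))"
    using v by metis
  have later: "inside (pfst (s t)) (pfst (s (h n)))" if "psnd (psnd (s t)) \<le> n" for t n
    using mono[of t "h n"] mono[of "h n" t] h(2)[of n] that by (cases "t \<le> h n") auto
  have close: "dist (\<alpha> (v n)) (\<alpha> (v k)) < 1 / 2 ^ k" if "k \<le> n" for k n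
  proof -
    \<comment> \<open>The time when the ball has been shrunk \<open>k + 1\<close> times; both centres are in the ball of this time.\<close>
    define t where "t = (LEAST t. Suc k \<le> psnd (psnd (s t)))"
    have t: "Suc k \<le> psnd (psnd (s t))"
      unfolding t_def using h(2) by (rule LeastI)
    have near: "dist (\<alpha> (pfst (pfst (s t)))) (\<alpha> (v n)) < 1 / 2 ^ Suc k" if "k \<le> n" for n
    proof -
      have "t \<le> h n"
        unfolding t_def using h(2)[of n] that by (intro Least_le) simp
      then have "pfst (s (h n)) = pfst (s t) \<or> inside (pfst (s t)) (pfst (s (h n)))"
        using mono by blast
      moreover have "1 / 2 ^ psnd (pfst (s t)) \<le> (1 / 2 ^ Suc k :: real)"
        using t ball_run_count_le[of "map y [0..<t]"] unfolding s_def
        by (intro divide_left_mono power_increasing) auto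
      moreover have "d < c" if "d + a < b" "b \<le> c" "0 < a" for a b c d :: real
        using that by linarith
      ultimately show ?thesis
        unfolding h(1) inside_def by (metis dist_self zero_less_divide_1_iff zero_less_numeral zero_less_power)
    qed
    have "dist (\<alpha> (v n)) (\<alpha> (v k)) < 1 / 2 ^ Suc k + 1 / 2 ^ Suc k"
      using near[OF that] near[of k] dist_triangle3[of "\<alpha> (v n)" "\<alpha> (v k)" "\<alpha> (pfst (pfst (s t)))"]
      by simp
    then show ?thesis by simp
  qed
  have "Cauchy (\<lambda>n. \<alpha> (v n))"
    unfolding metric_Cauchy_iff2
  proof (intro allI)
    fix j
    obtain k where k: "1 / 2 ^ k < inverse (real (Suc j))"
      using reals_power_lt_ex[of "inverse (real (Suc j))" 2] by (auto simp: power_one_over)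
    have "dist (\<alpha> (v m)) (\<alpha> (v n)) < inverse (real (Suc j))" if "Suc k \<le> m" "Suc k \<le> n" for m n
    proof -
      have "dist (\<alpha> (v m)) (\<alpha> (v n)) < 1 / 2 ^ Suc k + 1 / 2 ^ Suc k"
        using close[OF that(1)] close[OF that(2)]
          dist_triangle2[of "\<alpha> (v m)" "\<alpha> (v n)" "\<alpha> (v (Suc k))"] by simp
      then show ?thesis using k by simp
    qed
    then show "\<exists>M. \<forall>m\<ge>M. \<forall>n\<ge>M. dist (\<alpha> (v m)) (\<alpha> (v n)) < inverse (real (Suc j))"
      by blast
  qed
  then obtain x where x: "(\<lambda>n. \<alpha> (v n)) \<longlonglongrightarrow> x"
    using Cauchy_convergent_iff convergent_def by blast
  then have "cauchy_rep dist \<alpha> v = Some x"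
    using close by (simp add: cauchy_rep_dist_eq_Some_iff comp_def)
  moreover have "dist (\<alpha> (pfst (pfst (s t)))) x < 1 / 2 ^ psnd (pfst (s t))" for t
  proof -
    define n where "n = psnd (psnd (s t))"
    define t' where "t' = h n"
    have t': "inside (pfst (s t)) (pfst (s t'))"
      unfolding t'_def n_def by (intro later) simp
    have "dist (\<alpha> (pfst (pfst (s t')))) (\<alpha> (v m)) \<le> 1 / 2 ^ psnd (pfst (s t'))" if "psnd (psnd (s t')) \<le> m" for m
    proof -
      have "0 < (1 / 2 ^ psnd (pfst (s (h m))) :: real)"
        by simp
      then show ?thesis
        using later[OF that] unfolding h(1) inside_def by linarith
    qed
    then have "dist (\<alpha> (pfst (pfst (s t')))) x \<le> 1 / 2 ^ psnd (pfst (s t'))"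
      by (intro Lim_dist_ubound[OF _ x]) (auto simp: eventually_sequentially)
    then show ?thesis
      using t' dist_triangle[of "\<alpha> (pfst (pfst (s t)))" x "\<alpha> (pfst (pfst (s t')))"]
      by (auto simp: inside_def)
  qed
  ultimately show ?thesis by blast
qed

end

lemma nowhere_dense_ball_avoiding:
  assumes "closed A" "interior A = {}"
  shows "\<exists>b'. inside b b' \<and> ball (\<alpha> (pfst b')) (1 / 2 ^ psnd b') \<inter> A = {}"
proof -
  let ?U = "ball (\<alpha> (pfst b)) (1 / 2 ^ psnd b)"
  have "open (?U - A)"
    using assms(1) by (simp add: open_Diff)
  moreover have "\<alpha> (pfst b) \<in> ?U"
    by simp
  then have "?U - A \<noteq> {}"
    using assms(2) interior_maximal[of ?U A] by blast
  ultimately obtain m where m: "\<alpha> m \<in> ?U - A"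
    using open_meets_dense_sequence[of "?U - A" _ "{}"] by blast
  obtain e where e: "e > 0" "ball (\<alpha> m) e \<subseteq> ?U - A"
    using \<open>open (?U - A)\<close> m openE by blast
  define d where "d = min e (1 / 2 ^ psnd b - dist (\<alpha> (pfst b)) (\<alpha> m))"
  have "d > 0"
    using e(1) m by (simp add: d_def)
  then obtain k where k: "1 / 2 ^ k < d"
    using reals_power_lt_ex[of d 2] by (auto simp: power_one_over)
  have "1 / 2 ^ k < (1 / 2 ^ psnd b :: real)"
    using k zero_le_dist[of "\<alpha> (pfst b)" "\<alpha> m"] unfolding d_def by linarith
  then have "(2 :: real) ^ psnd b < 2 ^ k"
    by (simp add: field_simps)
  then have "psnd b < k"
    by simp
  then have "inside b (pair m k)"
    using k by (simp add: inside_def d_def)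
  moreover have "ball (\<alpha> m) (1 / 2 ^ k) \<inter> A = {}"
    using e(2) k subset_ball[of "1 / 2 ^ k" e "\<alpha> m"] by (auto simp: d_def)
  ultimately show ?thesis
    by (intro exI[of _ "pair m k"]) simp
qed

lemma ball_Int_closure_eq_empty_iff:
  "ball a r \<inter> closure S = {} \<longleftrightarrow> ball a r \<inter> S = {}"
  by (rule open_Int_closure_eq_empty) simp

text \<open>
  A word is good for \<open>A\<^sub>i\<close> if it contains at least \<open>i\<close> ones and its ball is disjoint from \<open>A\<^sub>i\<close>. An open ball
  is disjoint from \<open>A\<^sub>i\<close> if and only if none of the points listed by the name of \<open>A\<^sub>i\<close> is in it, so the bad
  words can be enumerated. As \<open>A\<^sub>i\<close> is nowhere dense, every word can be extended to a good one. A sequence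
  with good prefixes for all \<open>i\<close> therefore has infinitely many ones and determines a point outside
  all \<open>A\<^sub>i\<close>.
\<close>

lemma BCT2_le_Pi01_G: "BCT2 \<alpha> \<le>\<^sub>s\<^sub>W Pi01_G"
proof -
  obtain R where R: "decidable (\<lambda>p z. R (pfst z) (psnd z))"
      "\<And>n. inside (pfst n) (psnd n) \<longleftrightarrow> (\<exists>u. R n u)"
    using semidecidable_oracle_freeE[OF semidecidable_inside] by blast
  have step: "recursive (\<lambda>p n. ball_step R (f p n) (g p n))" if "recursive f" "recursive g" for f g
    unfolding ball_step_def Let_def by (intro recursive_intros decidable_compose2[OF R(1)] that)
  define run where "run = word_run (ball_step R) (pair (pair 0 0) (pair 0 0))"
  have run: "run (word_code w) = ball_run R w" for w
    unfolding run_def ball_run_def by (rule word_run_eq_foldl)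
  have rec_run: "recursive (\<lambda>p n. run (f p n))" if "recursive f" for f
    unfolding run_def by (intro recursive_word_run step that recursive_intros)
  \<comment> \<open>Here \<open>n\<close> is a pair of \<open>i\<close> and the code of a word. The positive entries of a name are, up to the shift by one, Cauchy names of the listed points.\<close>
  define bad where "bad p n \<longleftrightarrow> (let i = pfst n; s = run (psnd n) in
      psnd (psnd s) < i \<or>
      (\<exists>z l. p (pair i (pair z l)) \<noteq> 0 \<and>
         dist (\<alpha> (p (pair i (pair z l)) - 1)) (\<alpha> (pfst (pfst s))) + 1 / 2 ^ l < 1 / 2 ^ psnd (pfst s)))"
    for p n
  have "semidecidable bad"
    unfolding bad_def Let_def
    by (intro semidecidable_intros computable_real_intros recursive_intros rec_run
        decidable_imp_semidecidable[OF decidable_less] decidable_imp_semidecidable[OF decidable_not])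
  then obtain B where B: "decidable (\<lambda>p z. B p (pfst z) (psnd z))" "\<And>p n. bad p n \<longleftrightarrow> (\<exists>u. B p n u)"
    using semidecidableE by blast
  define K where "K p n = (if B p (pair (pfst n) (pfst (psnd n))) (psnd (psnd n))
      then Suc (pfst (psnd n)) else 0)" for p n
  have K: "recursive K"
    unfolding K_def by (intro recursive_intros decidable_compose2[OF B(1)])
  have words: "w \<in> psi_minus_words (component (K p) i) \<longleftrightarrow> \<not> bad p (pair i (word_code w))" for w p i
  proof -
    have "(\<exists>n. K p (pair i n) = Suc (word_code w)) \<longleftrightarrow> (\<exists>u. B p (pair i (word_code w)) u)"
    proof
      assume "\<exists>u. B p (pair i (word_code w)) u"
      then obtain u where "B p (pair i (word_code w)) u" ..
      then have "K p (pair i (pair (word_code w) u)) = Suc (word_code w)"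
        by (simp add: K_def)
      then show "\<exists>n. K p (pair i n) = Suc (word_code w)" ..
    qed (auto simp: K_def split: if_splits)
    then show ?thesis
      unfolding mem_psi_minus_words_iff component_def B(2) by blast
  qed
  \<comment> \<open>The same run as for words, now driven by the digits of the oracle.\<close>
  define orbit where "orbit q t = rec_nat (pair (pair 0 0) (pair 0 0)) (\<lambda>j s. ball_step R s (q j)) t" for q t
  have rec_orbit: "recursive (\<lambda>p n. orbit p (f p n))" if "recursive f" for f
    unfolding orbit_def by (intro recursive_intros step that)
  have orbit: "orbit q t = ball_run R (map y [0..<t])" if "\<And>n. q n = of_bool (y n)" for q y t
    by (induction t) (auto simp: orbit_def ball_run_def that)
  have "semidecidable (\<lambda>q z. \<exists>t. psnd z = pfst (pfst (orbit q t)) \<and> pfst z < psnd (psnd (orbit q t)))"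
    by (intro semidecidable_intros decidable_imp_semidecidable recursive_intros rec_orbit)
  then obtain \<Phi> where \<Phi>: "partial_recursive \<Phi>"
    "\<And>q n. \<exists>v t. v = pfst (pfst (orbit q t)) \<and> n < psnd (psnd (orbit q t)) \<Longrightarrow>
       \<exists>v. \<Phi> q n = Some v \<and> (\<exists>t. v = pfst (pfst (orbit q t)) \<and> n < psnd (psnd (orbit q t)))"
    by (rule semidecidable_selection[where
          S = "\<lambda>q n v. \<exists>t. v = pfst (pfst (orbit q t)) \<and> n < psnd (psnd (orbit q t))"]) blast
  show ?thesis
  proof (rule sW_reducibleI[OF K \<Phi>(1)])
    fix p A
    assume in_rep: "in_rep (BCT2 \<alpha>) p = Some A" and "A \<in> mv_dom (multi (BCT2 \<alpha>))"
    then have A: "\<And>i. closed (A i)" "\<And>i. interior (A i) = {}"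
      by (auto simp: BCT2_def mv_dom_bct)
    have psi: "psi_plus \<alpha> (component p i) = Some (A i)" for i
    proof -
      have "component p i \<in> dom (psi_plus \<alpha>)" "A i = the (psi_plus \<alpha> (component p i))" for i
        using in_rep by (auto simp: BCT2_def seq_rep_def split: if_splits)
      then show ?thesis by (metis domD option.sel)
    qed
    have names: "\<exists>l. p (pair i (pair z l)) \<noteq> 0 \<and>
         dist (\<alpha> (p (pair i (pair z l)) - 1)) c + 1 / 2 ^ l < r"
      if g: "\<And>l. p (pair i (pair z l)) = Suc (g l)" "cauchy_rep dist \<alpha> g = Some x" "dist c x < r" for i z g x c r
    proof -
      obtain l where l: "1 / 2 ^ l + 1 / 2 ^ l < r - dist c x"
        using ex_twice_inverse_power_less[of "r - dist c x"] g(3) by auto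
      moreover have "v + e < r" if "e + e < r - d" "u \<le> e" "v \<le> u + d" for d e u v :: real
        using that by linarith
      ultimately have "dist (\<alpha> (g l)) c + 1 / 2 ^ l < r"
        using cauchy_rep_distD[OF g(2), of l] dist_triangle[of "\<alpha> (g l)" c x]
        by (metis dist_commute)
      then show ?thesis
        using g(1) by (intro exI[of _ l]) simp
    qed
    have good: "\<not> bad p (pair i (word_code w)) \<longleftrightarrow> i \<le> psnd (psnd (ball_run R w)) \<and>
        ball (\<alpha> (pfst (pfst (ball_run R w)))) (1 / 2 ^ psnd (pfst (ball_run R w))) \<inter> A i = {}" for i w
    proof -
      define c where "c = \<alpha> (pfst (pfst (ball_run R w)))"
      define r :: real where "r = 1 / 2 ^ psnd (pfst (ball_run R w))"
      let ?P = "{x. \<exists>z g. (\<forall>l. component p i (pair z l) = Suc (g l)) \<and> cauchy_rep dist \<alpha> g = Some x}"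
      have "(\<exists>z l. p (pair i (pair z l)) \<noteq> 0 \<and> dist (\<alpha> (p (pair i (pair z l)) - 1)) c + 1 / 2 ^ l < r)
          \<longleftrightarrow> ball c r \<inter> ?P \<noteq> {}"
      proof
        assume "\<exists>z l. p (pair i (pair z l)) \<noteq> 0 \<and> dist (\<alpha> (p (pair i (pair z l)) - 1)) c + 1 / 2 ^ l < r"
        then obtain z l where zl: "p (pair i (pair z l)) \<noteq> 0"
          "dist (\<alpha> (p (pair i (pair z l)) - 1)) c + 1 / 2 ^ l < r" by blast
        have "component (component p i) z \<in> dom (cauchy_rep dist_inf (dense_inf \<alpha>))"
          using psi[of i] by (auto simp: psi_plus_def seq_rep_def split: if_splits)
        then obtain y where "cauchy_rep dist_inf (dense_inf \<alpha>) (component (component p i) z) = Some y"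
          by blast
        then show "ball c r \<inter> ?P \<noteq> {}"
        proof (cases rule: cauchy_rep_inf_cases)
          case 1
          then show ?thesis using zl(1) by (simp add: component_def)
        next
          case (2 x g)
          then have "dist (\<alpha> (g l)) x \<le> 1 / 2 ^ l" "dist (\<alpha> (g l)) c + 1 / 2 ^ l < r"
            using cauchy_rep_distD zl(2) by (auto simp: component_def)
          then have "x \<in> ball c r"
            using dist_triangle[of c x "\<alpha> (g l)"] by (simp add: dist_commute)
          moreover have "x \<in> ?P"
            using 2(2,3) by (auto simp: component_def)
          ultimately show ?thesis by blast
        qed
      next
        assume "ball c r \<inter> ?P \<noteq> {}"
        then obtain x z g where "dist c x < r" "\<forall>l. p (pair i (pair z l)) = Suc (g l)" "cauchy_rep dist \<alpha> g = Some x"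
          by (auto simp: component_def)
        with names[of i z g x c r]
        show "\<exists>z l. p (pair i (pair z l)) \<noteq> 0 \<and> dist (\<alpha> (p (pair i (pair z l)) - 1)) c + 1 / 2 ^ l < r"
          by blast
      qed
      then show ?thesis
        unfolding psi_plus_eq_closure[OF psi[of i]] ball_Int_closure_eq_empty_iff bad_def Let_def
        by (auto simp: run c_def r_def)
    qed
    define E where "E i = psi_minus_words (component (K p) i)" for i
    have E: "w \<in> E i \<longleftrightarrow> i \<le> psnd (psnd (ball_run R w)) \<and>
        ball (\<alpha> (pfst (pfst (ball_run R w)))) (1 / 2 ^ psnd (pfst (ball_run R w))) \<inter> A i = {}" for w i
      unfolding E_def words good ..
    define C where "C i = UNIV - (\<Union>w\<in>E i. cylinder w)" for i
    have "\<exists>u. w @ u \<in> E i" for w i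
    proof -
      have count: "\<exists>u. j \<le> psnd (psnd (ball_run R (w @ u)))" for j
      proof (induction j)
        case (Suc j)
        then obtain u where "j \<le> psnd (psnd (ball_run R (w @ u)))" ..
        then have "Suc j \<le> psnd (psnd (ball_run R (w @ u @ [True])))"
          using ball_run_snoc[of R "w @ u" True] by (simp add: ball_step_def Let_def)
        then show ?case ..
      qed simp
      obtain u where u: "i \<le> psnd (psnd (ball_run R (w @ u)))"
        using count by blast
      obtain b where b: "inside (pfst (ball_run R ((w @ u) @ [True]))) b"
          "ball (\<alpha> (pfst b)) (1 / 2 ^ psnd b) \<inter> A i = {}"
        using nowhere_dense_ball_avoiding[OF A] by blast
      obtain u' where "pfst (ball_run R ((w @ u) @ u')) = b"
          "psnd (psnd (ball_run R (w @ u))) < psnd (psnd (ball_run R ((w @ u) @ u')))"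
        using ball_run_jump[OF R(2) b(1)] by blast
      then have "w @ (u @ u') \<in> E i"
        using u b(2) by (simp add: E)
      then show ?thesis ..
    qed
    then have C: "\<forall>i. closed (C i) \<and> interior (C i) = {}"
      unfolding C_def using closed_complement_of_cylinders dense_words_interior_empty by blast
    have "in_rep Pi01_G (K p) = Some C"
      by (simp add: Pi01_G_def seq_rep_psi_sharp C_def[abs_def] E_def)
    moreover have "C \<in> mv_dom (multi Pi01_G)"
      using C by (simp add: Pi01_G_def mv_dom_pi01_generic)
    moreover have "\<exists>r z. (\<forall>n. \<Phi> q n = Some (r n)) \<and> out_rep (BCT2 \<alpha>) r = Some z \<and> z \<in> multi (BCT2 \<alpha>) A"
      if q: "out_rep Pi01_G q = Some y" and y: "y \<in> multi Pi01_G C" for q y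
    proof -
      have y: "y \<notin> C i" for i
        using y C by (auto simp: Pi01_G_def pi01_generic_def split: if_splits)
      have bits: "q n = of_bool (y n)" for n
        using cantor_rep_eq_SomeD q by (simp add: Pi01_G_def)
      have prefix: "\<exists>t. map y [0..<t] \<in> E i" for i
        using y[of i] by (auto simp: C_def mem_cylinder_iff) metis
      have "\<exists>v t. v = pfst (pfst (orbit q t)) \<and> n < psnd (psnd (orbit q t))" for n
        using prefix[of "Suc n"] by (auto simp: E orbit[OF bits] Suc_le_eq)
      then have "\<forall>n. \<exists>v. \<Phi> q n = Some v \<and> (\<exists>t. v = pfst (pfst (orbit q t)) \<and> n < psnd (psnd (orbit q t)))"
        by (intro allI \<Phi>(2))
      from choice[OF this] obtain v where v: "\<And>n. \<Phi> q n = Some (v n)"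
        "\<And>n. \<exists>t. v n = pfst (pfst (orbit q t)) \<and> n < psnd (psnd (orbit q t))"
        by blast
      obtain x where x: "cauchy_rep dist \<alpha> v = Some x"
        "\<And>t. dist (\<alpha> (pfst (pfst (ball_run R (map y [0..<t]))))) x < 1 / 2 ^ psnd (pfst (ball_run R (map y [0..<t])))"
        using ball_run_limit[OF R(2), where v = v and y = y] v(2) by (auto simp: orbit[OF bits] Suc_le_eq)
      have "x \<notin> A i" for i
      proof -
        obtain t where t: "map y [0..<t] \<in> E i"
          using prefix by blast
        have "x \<in> ball (\<alpha> (pfst (pfst (ball_run R (map y [0..<t])))))
            (1 / 2 ^ psnd (pfst (ball_run R (map y [0..<t]))))"
          using x(2) by simp
        with t show ?thesis
          unfolding E by blast
      qed
      then have "x \<in> bct A"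
        using A by (simp add: bct_def)
      with v(1) x(1) show ?thesis
        by (auto simp: BCT2_def)
    qed
    ultimately show "\<exists>u. in_rep Pi01_G (K p) = Some u \<and> u \<in> mv_dom (multi Pi01_G) \<and>
        (\<forall>q y. out_rep Pi01_G q = Some y \<and> y \<in> multi Pi01_G u \<longrightarrow>
          (\<exists>r z. (\<forall>n. \<Phi> q n = Some (r n)) \<and> out_rep (BCT2 \<alpha>) r = Some z \<and> z \<in> multi (BCT2 \<alpha>) A))"
      by blast
  qed
qed

end

section \<open>Balls whose boundary avoids the dense sequence\<close>

lemma ex_subinterval_avoiding:
  assumes "x < (y :: real)" "0 < e"
  shows "\<exists>a b. x < rat_value a \<and> rat_value a < rat_value b \<and> rat_value b < y \<and>
    rat_value b - rat_value a < e \<and> (d < rat_value a \<or> rat_value b < d)"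
proof -
  obtain m where m: "x < m" "m < y"
    using dense[OF assms(1)] by blast
  \<comment> \<open>The part of the interval on the side of \<open>m\<close> where \<open>d\<close> is not.\<close>
  define l u where "l = (if d < m then m else x)" and "u = (if d < m then y else m)"
  have "l < u"
    using m by (simp add: l_def u_def)
  then obtain a where a: "l < rat_value a" "rat_value a < u"
    using rat_value_between by blast
  then obtain b where b: "rat_value a < rat_value b" "rat_value b < min u (rat_value a + e)"
    using rat_value_between[of "rat_value a" "min u (rat_value a + e)"] assms(2) by auto
  have "x < rat_value a" "rat_value b < y" "d < rat_value a \<or> rat_value b < d"
    using a b m by (auto simp: l_def u_def split: if_splits)
  then show ?thesis
    using b by (intro exI[of _ a] exI[of _ b]) auto
qed

context effective_perfect_polish
begin

text \<open>
  If no distance between elements of the dense sequence equals a radius, it is decidable which elements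
  are in which ball, and the boundaries of the balls are nowhere dense. Such a radius is the
  common point of nested intervals: in step \<open>m\<close> a subinterval is searched that has the distance of
  \<open>\<alpha> m\<close> outside.
\<close>

lemma ex_generic_radii:
  "\<exists>r. computable_real (\<lambda>p. r) \<and>
     (\<forall>k. 0 < r k \<and> r k < 1 / 2 ^ psnd k \<and> (\<forall>m. dist (\<alpha> m) (\<alpha> (pfst k)) \<noteq> r k))"
proof -
  \<comment> \<open>Here \<open>N = \<langle>\<langle>k, m\<rangle>, I\<rangle>\<close>: the interval \<open>I\<close> is refined to \<open>v\<close> in step \<open>m\<close> for ball \<open>k\<close>. The first disjunct makes the search total.\<close>
  define S where "S N v \<longleftrightarrow> \<not> rat_value (pfst (psnd N)) < rat_value (psnd (psnd N)) \<or>
      rat_value (pfst (psnd N)) < rat_value (pfst v) \<and>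
      rat_value (pfst v) < rat_value (psnd v) \<and>
      rat_value (psnd v) < rat_value (psnd (psnd N)) \<and>
      rat_value (psnd v) - rat_value (pfst v) < 1 / 2 ^ psnd (pfst N) \<and>
      (dist (\<alpha> (psnd (pfst N))) (\<alpha> (pfst (pfst (pfst N)))) < rat_value (pfst v) \<or>
       rat_value (psnd v) < dist (\<alpha> (psnd (pfst N))) (\<alpha> (pfst (pfst (pfst N)))))" for N v
  have "semidecidable (\<lambda>p z. S (pfst z) (psnd z))"
    unfolding S_def
    by (intro semidecidable_intros computable_real_intros recursive_intros
        decidable_imp_semidecidable[OF decidable_not])
  moreover have "\<exists>v. S N v" for N
  proof (cases "rat_value (pfst (psnd N)) < rat_value (psnd (psnd N))")
    case True
    obtain a b where "rat_value (pfst (psnd N)) < rat_value a \<and> rat_value a < rat_value b \<and>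
        rat_value b < rat_value (psnd (psnd N)) \<and> rat_value b - rat_value a < 1 / 2 ^ psnd (pfst N) \<and>
        (dist (\<alpha> (psnd (pfst N))) (\<alpha> (pfst (pfst (pfst N)))) < rat_value a \<or>
         rat_value b < dist (\<alpha> (psnd (pfst N))) (\<alpha> (pfst (pfst (pfst N)))))"
      using ex_subinterval_avoiding[OF True, of "1 / 2 ^ psnd (pfst N)"
          "dist (\<alpha> (psnd (pfst N))) (\<alpha> (pfst (pfst (pfst N))))"] by auto
    then have "S N (pair a b)"
      by (simp add: S_def)
    then show ?thesis ..
  qed (simp add: S_def)
  ultimately obtain f where f: "recursive (\<lambda>p. f)" "\<And>N. S N (f N)"
    using semidecidable_choice_oracle_free[of S] by blast
  \<comment> \<open>The interval of step \<open>m\<close> for ball \<open>k\<close>, starting from \<open>[0, 1 / 2 ^ psnd k]\<close>; the numbers are codes of rationals.\<close>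
  define J where "J k m = rec_nat (pair 0 (pair (pair 1 0) (2 ^ psnd k - 1))) (\<lambda>m s. f (pair (pair k m) s)) m" for k m
  define lo where "lo k m = rat_value (pfst (J k m))" for k m
  define hi where "hi k m = rat_value (psnd (J k m))" for k m
  have lo0: "lo k 0 = 0" and hi0: "hi k 0 = 1 / 2 ^ psnd k" for k
    by (simp_all add: lo_def hi_def J_def rat_value_def prod_decode_0 del: of_nat_Suc)
  have step: "\<not> lo k m < hi k m \<or> lo k m < lo k (Suc m) \<and> lo k (Suc m) < hi k (Suc m) \<and>
      hi k (Suc m) < hi k m \<and> hi k (Suc m) - lo k (Suc m) < 1 / 2 ^ m \<and>
      (dist (\<alpha> m) (\<alpha> (pfst k)) < lo k (Suc m) \<or> hi k (Suc m) < dist (\<alpha> m) (\<alpha> (pfst k)))" for k m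
    using f(2)[of "pair (pair k m) (J k m)"] by (simp add: S_def lo_def hi_def J_def)
  have less: "lo k m < hi k m" for k m
    by (induction m) (use step lo0 hi0 in auto)
  have lo_less: "lo k m < lo k (Suc m)" and hi_less: "hi k (Suc m) < hi k m"
    and width: "hi k (Suc m) - lo k (Suc m) < 1 / 2 ^ m"
    and avoid: "dist (\<alpha> m) (\<alpha> (pfst k)) < lo k (Suc m) \<or> hi k (Suc m) < dist (\<alpha> m) (\<alpha> (pfst k))" for k m
    using step[of k m] less[of k m] by auto
  have "incseq (lo k)" "decseq (hi k)" for k
    using lo_less hi_less by (auto intro!: incseq_SucI decseq_SucI less_imp_le)
  then have lo_hi: "lo k m \<le> hi k m'" for k m m'
    using less[of k "max m m'"] incseqD[of "lo k" m "max m m'"] decseqD[of "hi k" m' "max m m'"]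
    by (simp add: max_def split: if_splits)
  define r where "r k = (SUP m. lo k m)" for k
  have "bdd_above (range (lo k))" for k
    using lo_hi by (intro bdd_aboveI[of _ "hi k 0"]) auto
  then have bounds: "lo k m \<le> r k" "r k \<le> hi k m" for k m
    using lo_hi by (auto simp: r_def intro: cSUP_upper cSUP_least)
  have "computable_real (\<lambda>p. r)"
  proof (rule computable_realI[of "\<lambda>p k m. pfst (J k (Suc m))"])
    have rec_f: "recursive (\<lambda>p n. f (g p n))" if "recursive g" for g
      using recursive_compose[OF f(1) that] .
    show "recursive (\<lambda>p z. pfst (J (pfst z) (Suc (psnd z))))"
      unfolding J_def by (intro recursive_intros rec_f)
    show "\<bar>r k - rat_value (pfst (J k (Suc m)))\<bar> \<le> 1 / 2 ^ m" for k m
      using bounds[of k "Suc m"] width[of k m] by (simp add: lo_def)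
  qed
  moreover have "0 < r k" "r k < 1 / 2 ^ psnd k" for k
    using bounds[of k 1] lo_less[of k 0] hi_less[of k 0] lo0 hi0 by simp_all
  moreover have "dist (\<alpha> m) (\<alpha> (pfst k)) \<noteq> r k" for k m
    using bounds[of k "Suc m"] avoid[of m k] by auto
  ultimately show ?thesis by blast
qed

end

section \<open>A tree of open cells\<close>

text \<open>
  Ball number \<open>k\<close> is the one with centre \<open>\<alpha> (pfst k)\<close> and radius \<open>r k\<close>.
\<close>

locale generic_radii = effective_perfect_polish \<alpha>
  for \<alpha> :: "nat \<Rightarrow> 'a::{polish_space, perfect_space}" +
  fixes r :: "nat \<Rightarrow> real"
  assumes computable_radius: "computable_real (\<lambda>p. r)"
    and radius_pos: "0 < r k"
    and radius_less: "r k < 1 / 2 ^ psnd k"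
    and radius_avoids: "dist (\<alpha> m) (\<alpha> (pfst k)) \<noteq> r k"
begin

text \<open>
  A cell is given by a list of entries \<open>\<langle>\<langle>k, m\<rangle>, d\<rangle>\<close>, where \<open>d\<close> tells whether the cell lies outside
  (\<open>d = 0\<close>) or inside ball \<open>k\<close>. In the tree, \<open>m\<close> is the index of an element of the dense
  sequence outside the ball. Points on the boundary are on neither side.
\<close>

definition side :: "nat \<Rightarrow> 'a set" where
  "side e = (let k = pfst (pfst e) in
     if psnd e = 0 then {x. r k < dist x (\<alpha> (pfst k))} else {x. dist x (\<alpha> (pfst k)) < r k})"

definition cell :: "nat \<Rightarrow> 'a set" where
  "cell s = (\<Inter>e\<in>set (list_decode s). side e)"

lemma computable_real_radius [computable_real_intros]:
  "recursive f \<Longrightarrow> computable_real (\<lambda>p n. r (f p n))"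
  by (rule computable_real_compose[OF computable_radius])

lemma decidable_inside_ball:
  assumes "recursive f" "recursive g"
  shows "decidable (\<lambda>p n. dist (\<alpha> (f p n)) (\<alpha> (pfst (g p n))) < r (g p n))"
proof -
  have "\<not> dist (\<alpha> m) (\<alpha> (pfst k)) < r k \<longleftrightarrow> r k < dist (\<alpha> m) (\<alpha> (pfst k))" for m k
    using radius_avoids[of m k] by auto
  then have "decidable (\<lambda>p n. dist (\<alpha> (pfst n)) (\<alpha> (pfst (psnd n))) < r (psnd n))"
    by (intro decidable_by_complement; simp only:)
      (intro semidecidable_intros computable_real_intros recursive_intros)+
  from decidable_compose2[of "\<lambda>p m k. dist (\<alpha> m) (\<alpha> (pfst k)) < r k", OF this assms]
  show ?thesis .
qed

lemma dense_point_in_side_iff: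
  "\<alpha> m \<in> side e \<longleftrightarrow> (psnd e = 0 \<longleftrightarrow> \<not> dist (\<alpha> m) (\<alpha> (pfst (pfst (pfst e)))) < r (pfst (pfst e)))"
  using radius_avoids[of m "pfst (pfst e)"] by (auto simp: side_def Let_def)

lemma decidable_cell [recursive_intros]:
  assumes "recursive f" "recursive g"
  shows "decidable (\<lambda>p n. \<alpha> (f p n) \<in> cell (g p n))"
proof -
  have cell: "\<alpha> m \<in> cell s \<longleftrightarrow> (\<forall>e\<in>set (list_decode s).
      (psnd e = 0 \<and> \<not> dist (\<alpha> m) (\<alpha> (pfst (pfst (pfst e)))) < r (pfst (pfst e))) \<or>
      (psnd e \<noteq> 0 \<and> dist (\<alpha> m) (\<alpha> (pfst (pfst (pfst e)))) < r (pfst (pfst e))))" for m s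
    unfolding cell_def INT_iff dense_point_in_side_iff by blast
  have "decidable (\<lambda>p n. \<alpha> (pfst n) \<in> cell (psnd n))"
    unfolding cell by (intro recursive_intros decidable_inside_ball)
  from decidable_compose2[of "\<lambda>p m s. \<alpha> m \<in> cell s", OF this assms] show ?thesis .
qed

lemma open_cell: "open (cell s)"
proof -
  have "open {x. dist x (\<alpha> c) < e}" "open {x. e < dist x (\<alpha> c)}" for c e
    by (intro open_Collect_less continuous_intros)+
  then have "open (side e)" for e
    by (simp add: side_def Let_def)
  then show ?thesis
    unfolding cell_def by (intro open_INT) auto
qed

text \<open>
  A semidecidable condition on indices that is sufficient for inclusion, and that holds for enough
  balls to exhaust the cell.
\<close>

definition formally_inside :: "nat \<Rightarrow> nat \<Rightarrow> bool" where
  "formally_inside b s \<longleftrightarrow> (\<forall>e\<in>set (list_decode s).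
     (psnd e = 0 \<and> r (pfst (pfst e)) + rat_value (psnd b)
        < dist (\<alpha> (pfst b)) (\<alpha> (pfst (pfst (pfst e))))) \<or>
     (psnd e \<noteq> 0 \<and> dist (\<alpha> (pfst b)) (\<alpha> (pfst (pfst (pfst e)))) + rat_value (psnd b)
        < r (pfst (pfst e))))"

lemma semidecidable_formally_inside:
  "semidecidable (\<lambda>p n. formally_inside (pfst n) (psnd n))"
  unfolding formally_inside_def
  by (intro semidecidable_intros computable_real_intros recursive_intros
      decidable_imp_semidecidable[OF decidable_eq] decidable_imp_semidecidable[OF decidable_not])

lemma formally_inside_subset:
  assumes "formally_inside b s" shows "basic_ball \<alpha> b \<subseteq> cell s"
proof
  fix x assume "x \<in> basic_ball \<alpha> b"
  then have x: "dist (\<alpha> (pfst b)) x < rat_value (psnd b)"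
    by (simp add: basic_ball_eq)
  show "x \<in> cell s"
    unfolding cell_def
  proof
    fix e assume "e \<in> set (list_decode s)"
    moreover define c where "c = \<alpha> (pfst (pfst (pfst e)))"
    ultimately have "(psnd e = 0 \<and> r (pfst (pfst e)) + rat_value (psnd b) < dist (\<alpha> (pfst b)) c) \<or>
        (psnd e \<noteq> 0 \<and> dist (\<alpha> (pfst b)) c + rat_value (psnd b) < r (pfst (pfst e)))"
      using assms unfolding formally_inside_def by blast
    then show "x \<in> side e"
      using x dist_triangle[of "\<alpha> (pfst b)" c x] dist_triangle[of x c "\<alpha> (pfst b)"]
      by (auto simp: side_def Let_def c_def[symmetric] dist_commute)
  qed
qed

lemma cell_covered:
  assumes "x \<in> cell s"
  shows "\<exists>b. formally_inside b s \<and> x \<in> basic_ball \<alpha> b"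
proof -
  \<comment> \<open>The distance by which \<open>x\<close> misses the boundary of the ball.\<close>
  define margin where "margin e = \<bar>dist x (\<alpha> (pfst (pfst (pfst e)))) - r (pfst (pfst e))\<bar>" for e
  define d where "d = Min (insert 1 (margin ` set (list_decode s)))"
  have "0 < margin e" if "e \<in> set (list_decode s)" for e
  proof -
    have "x \<in> side e"
      using assms that by (simp add: cell_def)
    then show ?thesis
      by (auto simp: margin_def side_def Let_def split: if_splits)
  qed
  then have "0 < d"
    by (simp add: d_def)
  have d: "d \<le> margin e" if "e \<in> set (list_decode s)" for e
    using that unfolding d_def by (intro Min_le) auto
  obtain j where j: "1 / 2 ^ j + 1 / 2 ^ j < d"
    using ex_twice_inverse_power_less[OF \<open>0 < d\<close>] ..
  obtain m where m: "dist (\<alpha> m) x < 1 / 2 ^ j"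
    using open_meets_dense_sequence[of "ball x (1 / 2 ^ j)" x "{}"] by (auto simp: dist_commute)
  obtain q where q: "dist (\<alpha> m) x < rat_value q" "rat_value q < 1 / 2 ^ j"
    using rat_value_between[OF m] by blast
  have small: "dist (\<alpha> m) x + rat_value q < d"
    using j m q(2) by linarith
  have "formally_inside (pair m q) s"
    unfolding formally_inside_def
  proof
    fix e assume e: "e \<in> set (list_decode s)"
    define c where "c = \<alpha> (pfst (pfst (pfst e)))"
    have "x \<in> side e"
      using assms e by (simp add: cell_def)
    then show "(psnd e = 0 \<and> r (pfst (pfst e)) + rat_value (psnd (pair m q))
          < dist (\<alpha> (pfst (pair m q))) (\<alpha> (pfst (pfst (pfst e))))) \<or>
        (psnd e \<noteq> 0 \<and> dist (\<alpha> (pfst (pair m q))) (\<alpha> (pfst (pfst (pfst e)))) + rat_value (psnd (pair m q))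
          < r (pfst (pfst e)))"
      using d[OF e] small dist_triangle[of "\<alpha> m" c x] dist_triangle[of x c "\<alpha> m"]
      by (auto simp: side_def Let_def margin_def c_def[symmetric] dist_commute split: if_splits)
  qed
  moreover have "x \<in> basic_ball \<alpha> (pair m q)"
    using q(1) by (simp add: basic_ball_eq)
  ultimately show ?thesis by blast
qed

text \<open>
  The point named by \<open>p\<close> has distance at most \<open>1 / 2 ^ l\<close> from \<open>\<alpha> (p l)\<close>, which is why an entry of the name with
  this tolerance puts the point on one side of a ball.
\<close>

definition named_inside :: "baire \<Rightarrow> nat \<Rightarrow> bool" where
  "named_inside p s \<longleftrightarrow> (\<forall>e\<in>set (list_decode s).
     (psnd e = 0 \<and> (\<exists>l. r (pfst (pfst e)) + 1 / 2 ^ l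
        < dist (\<alpha> (p l)) (\<alpha> (pfst (pfst (pfst e)))))) \<or>
     (psnd e \<noteq> 0 \<and> (\<exists>l. dist (\<alpha> (p l)) (\<alpha> (pfst (pfst (pfst e)))) + 1 / 2 ^ l
        < r (pfst (pfst e)))))"

lemma semidecidable_named_inside:
  assumes "recursive f"
  shows "semidecidable (\<lambda>p n. named_inside p (f p n))"
proof -
  have "semidecidable named_inside"
    unfolding named_inside_def
    by (intro semidecidable_intros computable_real_intros recursive_intros
        decidable_imp_semidecidable[OF decidable_eq] decidable_imp_semidecidable[OF decidable_not])
  from semidecidable_compose[OF this assms] show ?thesis .
qed

lemma named_inside_iff:
  assumes "cauchy_rep dist \<alpha> p = Some x"
  shows "named_inside p s \<longleftrightarrow> x \<in> cell s"
proof -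
  have near: "dist (\<alpha> (p l)) x \<le> 1 / 2 ^ l" for l
    using cauchy_rep_distD[OF assms] .
  have "(\<exists>l. d + 1 / 2 ^ l < dist (\<alpha> (p l)) c) \<longleftrightarrow> d < dist x c" for c d
  proof
    assume "\<exists>l. d + 1 / 2 ^ l < dist (\<alpha> (p l)) c"
    then obtain l where "d + 1 / 2 ^ l < dist (\<alpha> (p l)) c" ..
    then show "d < dist x c"
      using near[of l] dist_triangle[of "\<alpha> (p l)" c x] by linarith
  next
    assume "d < dist x c"
    then obtain l where l: "1 / 2 ^ l + 1 / 2 ^ l < dist x c - d"
      using ex_twice_inverse_power_less[of "dist x c - d"] by auto
    have "dist x c \<le> dist (\<alpha> (p l)) x + dist (\<alpha> (p l)) c"
      by (metis dist_commute dist_triangle)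
    with l near[of l] have "d + 1 / 2 ^ l < dist (\<alpha> (p l)) c"
      by linarith
    then show "\<exists>l. d + 1 / 2 ^ l < dist (\<alpha> (p l)) c" ..
  qed
  moreover have "(\<exists>l. dist (\<alpha> (p l)) c + 1 / 2 ^ l < d) \<longleftrightarrow> dist x c < d" for c d
  proof
    assume "\<exists>l. dist (\<alpha> (p l)) c + 1 / 2 ^ l < d"
    then obtain l where l: "dist (\<alpha> (p l)) c + 1 / 2 ^ l < d" ..
    have "dist x c \<le> dist (\<alpha> (p l)) x + dist (\<alpha> (p l)) c"
      by (metis dist_commute dist_triangle)
    then show "dist x c < d"
      using l near[of l] by linarith
  next
    assume "dist x c < d"
    then obtain l where l: "1 / 2 ^ l + 1 / 2 ^ l < d - dist x c"
      using ex_twice_inverse_power_less[of "d - dist x c"] by auto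
    with near[of l] dist_triangle[of "\<alpha> (p l)" c x] have "dist (\<alpha> (p l)) c + 1 / 2 ^ l < d"
      by linarith
    then show "\<exists>l. dist (\<alpha> (p l)) c + 1 / 2 ^ l < d" ..
  qed
  ultimately show ?thesis
    unfolding named_inside_def cell_def INT_iff side_def Let_def by auto
qed

text \<open>
  The index of an element of the dense sequence in a cell that was created by splitting: the centre
  of the ball, or the element outside it that is recorded in the entry. Whether it
  really is in the cell is decidable for an arbitrary list, and so \<open>split\<close> can be total.
\<close>

definition witness :: "nat \<Rightarrow> nat" where
  "witness s = (if s = 0 then 0
     else if psnd (pfst (s - 1)) = 0 then psnd (pfst (pfst (s - 1)))
     else pfst (pfst (pfst (pfst (s - 1)))))"

text \<open>
  Ball \<open>k = pfst z\<close> splits a cell of level \<open>t\<close> if its centre and the element with index \<open>psnd z\<close> are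
  elements of the cell inside and outside the ball. The radius of the ball is less than \<open>1 / 2 ^ t\<close>. Its
  centre has to be \<open>\<alpha> (pfst t)\<close> if this is in the cell; since \<open>pfst t\<close> takes every value infinitely often,
  every element of the dense sequence obtains arbitrarily small cells in its neighbourhood.
\<close>

definition splits :: "nat \<Rightarrow> nat \<Rightarrow> bool" where
  "splits s z \<longleftrightarrow>
     \<alpha> (pfst (pfst z)) \<in> cell s \<and> \<alpha> (psnd z) \<in> cell s \<and>
     \<not> dist (\<alpha> (psnd z)) (\<alpha> (pfst (pfst z))) < r (pfst z) \<and>
     length (list_decode s) \<le> psnd (pfst z) \<and>
     (\<alpha> (pfst (length (list_decode s))) \<in> cell s \<longrightarrow> pfst (pfst z) = pfst (length (list_decode s)))"

definition split :: "nat \<Rightarrow> nat" where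
  "split s = (LEAST z. \<alpha> (witness s) \<in> cell s \<longrightarrow> splits s z)"

definition child :: "nat \<Rightarrow> nat \<Rightarrow> nat" where
  "child s d = Suc (pair (pair (split s) d) s)"

definition node :: "bool list \<Rightarrow> nat" where
  "node w = foldl (\<lambda>s b. child s (of_bool b)) 0 w"

text \<open>
  An open set in a perfect space contains a second element of the dense sequence, and a sufficiently
  small ball separates it from the centre.
\<close>

lemma ex_splits:
  assumes "\<alpha> m \<in> cell s" shows "\<exists>z. splits s z"
proof -
  define t where "t = pfst (length (list_decode s))"
  define c where "c = (if \<alpha> t \<in> cell s then t else m)"
  have c: "\<alpha> c \<in> cell s" "\<alpha> t \<in> cell s \<longrightarrow> c = t"
    using assms by (auto simp: c_def)
  obtain m' where m': "\<alpha> m' \<in> cell s" "\<alpha> m' \<noteq> \<alpha> c"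
    using open_meets_dense_sequence[OF open_cell c(1), of "{\<alpha> c}"] by auto
  then obtain j where j: "1 / 2 ^ j < dist (\<alpha> m') (\<alpha> c)"
    using ex_inverse_power_less[of "dist (\<alpha> m') (\<alpha> c)"] by auto
  define k where "k = pair c (max j (length (list_decode s)))"
  have "r k < 1 / 2 ^ max j (length (list_decode s))"
    using radius_less[of k] by (simp add: k_def)
  also have "\<dots> \<le> 1 / 2 ^ j"
    by (intro divide_left_mono power_increasing) auto
  finally have "\<not> dist (\<alpha> m') (\<alpha> c) < r k"
    using j by simp
  then have "splits s (pair k m')"
    using c m' by (simp add: splits_def k_def t_def)
  then show ?thesis ..
qed

lemma splits_split: "\<alpha> (witness s) \<in> cell s \<Longrightarrow> splits s (split s)"
  using LeastI_ex[of "\<lambda>z. \<alpha> (witness s) \<in> cell s \<longrightarrow> splits s z"] ex_splits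
  by (auto simp: split_def)

lemma recursive_split [recursive_intros]:
  assumes "recursive f" shows "recursive (\<lambda>p n. split (f p n))"
proof -
  have "recursive (\<lambda>p s. split s)"
    unfolding split_def witness_def splits_def
  proof (rule recursive_Least)
    show "\<exists>z. \<alpha> (if s = 0 then 0 else if psnd (pfst (s - 1)) = 0 then psnd (pfst (pfst (s - 1)))
       else pfst (pfst (pfst (pfst (s - 1))))) \<in> cell s \<longrightarrow>
      \<alpha> (pfst (pfst z)) \<in> cell s \<and> \<alpha> (psnd z) \<in> cell s \<and>
     \<not> dist (\<alpha> (psnd z)) (\<alpha> (pfst (pfst z))) < r (pfst z) \<and>
     length (list_decode s) \<le> psnd (pfst z) \<and>
     (\<alpha> (pfst (length (list_decode s))) \<in> cell s \<longrightarrow> pfst (pfst z) = pfst (length (list_decode s)))" for s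
      using ex_splits unfolding splits_def by blast
  qed (intro recursive_intros decidable_inside_ball)
  from recursive_compose[OF this assms] show ?thesis .
qed

lemma recursive_child [recursive_intros]:
  "recursive f \<Longrightarrow> recursive g \<Longrightarrow> recursive (\<lambda>p n. child (f p n) (g p n))"
  unfolding child_def by (intro recursive_intros)

lemma cell_child: "cell (child s d) = side (pair (split s) d) \<inter> cell s"
  by (simp add: cell_def child_def)

lemma node_snoc: "node (w @ [b]) = child (node w) (of_bool b)"
  by (simp add: node_def)

lemma length_node: "length (list_decode (node w)) = length w"
  by (induction w rule: rev_induct) (simp add: node_def, simp add: node_snoc child_def)

lemma witness_in_node: "\<alpha> (witness (node w)) \<in> cell (node w)"
proof (induction w rule: rev_induct)
  case Nil
  show ?case by (simp add: node_def cell_def)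
next
  case (snoc b w)
  from splits_split[OF this] radius_pos[of "pfst (split (node w))"] show ?case
    unfolding node_snoc cell_child Int_iff dense_point_in_side_iff
    by (cases b) (simp_all add: witness_def child_def splits_def)
qed

lemma cell_node_append_subset: "cell (node (w @ u)) \<subseteq> cell (node w)"
proof (induction u rule: rev_induct)
  case (snoc b u)
  then show ?case
    using node_snoc[of "w @ u" b] by (auto simp: cell_child)
qed simp

lemma node_unique:
  assumes "x \<in> cell (node w)" "x \<in> cell (node w')" "length w = length w'"
  shows "w = w'"
  using assms
proof (induction w arbitrary: w' rule: rev_induct)
  case (snoc b w)
  then obtain b' v where w': "w' = v @ [b']" "length v = length w"
    by (cases w' rule: rev_cases) auto
  then have "w = v"
    using snoc by (auto simp: node_snoc cell_child)
  moreover have "b = b'"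
    using snoc.prems \<open>w = v\<close> unfolding w'(1) node_snoc cell_child
    by (cases b; cases b') (auto simp: side_def Let_def)
  ultimately show ?case
    using w'(1) by simp
qed simp

text \<open>
  A point off all boundaries is on one side of every split.
\<close>

lemma ex_node:
  assumes "\<And>k. dist x (\<alpha> (pfst k)) \<noteq> r k"
  shows "\<exists>w. length w = t \<and> x \<in> cell (node w)"
proof (induction t)
  case 0
  show ?case by (simp add: node_def cell_def)
next
  case (Suc t)
  then obtain w where w: "length w = t" "x \<in> cell (node w)" by blast
  define k where "k = pfst (split (node w))"
  have "x \<in> cell (node (w @ [dist x (\<alpha> (pfst k)) < r k]))"
    using w(2) assms[of k] unfolding node_snoc cell_child
    by (auto simp: side_def Let_def k_def)
  then show ?case
    using w(1) by (intro exI[of _ "w @ [dist x (\<alpha> (pfst k)) < r k]"]) simp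
qed

text \<open>
  Follow the branch of some \<open>\<alpha> m\<close> in the open set to a level \<open>t = \<langle>m, j\<rangle>\<close>. The cell of this level is split by a
  ball about \<open>\<alpha> m\<close> of radius less than \<open>1 / 2 ^ j\<close>, and the inner part is small enough.
\<close>

lemma open_contains_node:
  assumes "open U" "x \<in> U"
  shows "\<exists>w. cell (node w) \<subseteq> U"
proof -
  obtain m where "\<alpha> m \<in> U"
    using open_meets_dense_sequence[OF assms, of "{}"] by auto
  then obtain e where e: "e > 0" "ball (\<alpha> m) e \<subseteq> U"
    using assms(1) openE by blast
  obtain j where j: "1 / 2 ^ j < e"
    using ex_inverse_power_less[OF e(1)] ..
  define t where "t = pair m j"
  obtain w where w: "length w = t" "\<alpha> m \<in> cell (node w)"
    using ex_node[of "\<alpha> m" t] radius_avoids by blast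
  have z: "pfst (pfst (split (node w))) = m" "t \<le> psnd (pfst (split (node w)))"
    using splits_split[OF witness_in_node[of w]] w by (simp_all add: splits_def length_node t_def)
  have "j \<le> psnd (pfst (split (node w)))"
    using z(2) le_prod_encode_2[of j m] by (simp add: t_def)
  then have "(1 :: real) / 2 ^ psnd (pfst (split (node w))) \<le> 1 / 2 ^ j"
    by (intro divide_left_mono power_increasing) auto
  then have "r (pfst (split (node w))) < e"
    using radius_less[of "pfst (split (node w))"] j by linarith
  then have "cell (node (w @ [True])) \<subseteq> ball (\<alpha> m) e"
    using z(1) by (auto simp: node_snoc cell_child side_def Let_def dist_commute)
  with e(2) show ?thesis by blast
qed

lemma dist_neq_radius_dense: "interior {x. dist x (\<alpha> (pfst k)) = r k} = {}"
proof (rule ccontr)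
  assume "interior {x. dist x (\<alpha> (pfst k)) = r k} \<noteq> {}"
  then obtain m where "\<alpha> m \<in> interior {x. dist x (\<alpha> (pfst k)) = r k}"
    using open_meets_dense_sequence[OF open_interior, of _ _ "{}"] by blast
  then show False
    using interior_subset radius_avoids by blast
qed

text \<open>
  Every open set contains a cell, say of \<open>w\<close>. The dense set of words has an element \<open>v\<close> that is comparable
  with \<open>w\<close>, and then the cell of the longer of both words is contained in the cells of both.
\<close>

lemma union_of_nodes_dense:
  assumes "interior (UNIV - (\<Union>w\<in>E. cylinder w)) = {}"
  shows "interior (UNIV - (\<Union>w\<in>E. cell (node w))) = {}"
proof (rule ccontr)
  let ?I = "interior (UNIV - (\<Union>w\<in>E. cell (node w)))"
  assume "?I \<noteq> {}"
  then obtain w where w: "cell (node w) \<subseteq> ?I"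
    using open_contains_node[OF open_interior] by blast
  obtain v y where v: "v \<in> E" "y \<in> cylinder v" "y \<in> cylinder w"
    using interior_empty_meets_cylinder[OF assms, of w] by blast
  define n where "n = max (length v) (length w)"
  have prefix: "map y [0..<n] = u @ map y [length u..<n]" if "y \<in> cylinder u" "length u \<le> n" for u
    using that upt_add_eq_append[of 0 "length u" "n - length u"] by (simp add: mem_cylinder_iff)
  have "cell (node (map y [0..<n])) \<subseteq> cell (node v) \<inter> cell (node w)"
    using prefix[OF v(2)] prefix[OF v(3)] cell_node_append_subset
    by (metis le_inf_iff max.cobounded1 max.cobounded2 n_def)
  then have "\<alpha> (witness (node (map y [0..<n]))) \<in> cell (node v) \<inter> cell (node w)"
    using witness_in_node by blast
  then show False
    using w v(1) interior_subset[of "UNIV - (\<Union>w\<in>E. cell (node w))"] by blast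
qed

section \<open>From a generic point to a generic sequence\<close>

text \<open>
  Let \<open>E\<^sub>i\<close> be the set of words whose complement is enumerated. The input is translated to two kinds of
  dense open sets: the unions of the cells of the words in \<open>E\<^sub>i\<close>, and the complements of the boundaries
  of the balls. A point in all of them lies on a unique branch of the tree, and the branch has a
  prefix in each \<open>E\<^sub>i\<close>. The branch is found by waiting until a name of the point shows that it is in a
  cell. The enumeration of balls for \<open>E\<^sub>i\<close> is computable in the limit: a ball inside the cell of \<open>w\<close> is
  listed until \<open>w\<close> is seen to be outside \<open>E\<^sub>i\<close>, and replaced by the empty ball afterwards.
\<close>

lemma Pi01_G_le_jump_BCT0_with_radii: "Pi01_G \<le>\<^sub>s\<^sub>W jump (BCT0 \<alpha>)"
proof -
  define node_of where "node_of = word_run child 0"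
  have node_of: "node_of (word_code w) = node w" for w
    unfolding node_of_def node_def by (rule word_run_eq_foldl)
  have rec_node_of: "recursive (\<lambda>p n. node_of (f p n))" if "recursive f" for f
    unfolding node_of_def by (intro recursive_word_run that recursive_intros)
  obtain B where B: "decidable (\<lambda>p z. B (pfst z) (psnd z))"
    "\<And>n. formally_inside (pfst n) (psnd n) \<longleftrightarrow> (\<exists>u. B n u)"
    using semidecidable_oracle_freeE[OF semidecidable_formally_inside] by blast
  \<comment> \<open>The set number \<open>\<langle>i, 0\<rangle>\<close> is the union for \<open>E\<^sub>i\<close>; with a nonzero second component, it is the complement of the boundary of ball \<open>i\<close>, the union of the two one-entry cells given by \<open>c = 0\<close> and \<open>c \<noteq> 0\<close>.\<close>
  define target where "target i c = (if psnd i = 0 then node_of c else Suc (pair (pair (pair (pfst i) 0) c) 0))" for i c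
  \<comment> \<open>The \<open>a\<close>-th ball of a set: \<open>a = \<langle>\<langle>c, u\<rangle>, b\<rangle>\<close>, where \<open>u\<close> witnesses that ball \<open>b\<close> is inside the cell with number \<open>c\<close>. Code 0 stands for an empty ball.\<close>
  define valid where "valid i a \<longleftrightarrow> B (pair (psnd a) (target i (pfst (pfst a)))) (psnd (pfst a))" for i a
  define K where "K p n = (if (psnd (pfst (psnd n)) = 0 \<longrightarrow>
        (\<forall>t<pfst n. p (pair (pfst (pfst (psnd n))) t) \<noteq> Suc (pfst (pfst (psnd (psnd n)))))) \<and>
      valid (pfst (psnd n)) (psnd (psnd n)) then psnd (psnd (psnd n)) else 0)" for p n
  have K: "recursive K"
    unfolding K_def valid_def target_def
    by (intro recursive_intros decidable_compose2[OF B(1)] rec_node_of)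
  \<comment> \<open>The limit of the names that the stages of \<open>K p\<close> give.\<close>
  define q where "q p n = (if (psnd (pfst n) = 0 \<longrightarrow>
        (\<forall>t. p (pair (pfst (pfst n)) t) \<noteq> Suc (pfst (pfst (psnd n))))) \<and>
      valid (pfst n) (psnd n) then psnd (psnd n) else 0)" for p n
  have lim: "baire_lim (K p) = Some (q p)" for p
    unfolding baire_lim_eq_Some_iff
  proof
    fix n
    show "\<exists>t0. \<forall>t\<ge>t0. K p (pair t n) = q p n"
    proof (cases "\<exists>t. p (pair (pfst (pfst n)) t) = Suc (pfst (pfst (psnd n)))")
      case True
      then obtain t0 where "p (pair (pfst (pfst n)) t0) = Suc (pfst (pfst (psnd n)))" ..
      then have "K p (pair t n) = q p n" if "Suc t0 \<le> t" for t
        using that by (auto simp: K_def q_def)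
      then show ?thesis by blast
    qed (auto simp: K_def q_def)
  qed
  define E where "E p i = psi_minus_words (component p i)" for p i
  define U where "U p i = (if psnd i = 0 then \<Union>w\<in>E p (pfst i). cell (node w)
      else {x. dist x (\<alpha> (pfst (pfst i))) \<noteq> r (pfst i)})" for p i
  have balls: "(\<Union>a. basic_ball \<alpha> (q p (pair i a))) = U p i" for p i
  proof -
    define good where "good c \<longleftrightarrow> (psnd i = 0 \<longrightarrow> (\<forall>t. p (pair (pfst i) t) \<noteq> Suc c))" for c
    have "(\<Union>a. basic_ball \<alpha> (q p (pair i a))) = (\<Union>c\<in>Collect good. cell (target i c))"
    proof (intro equalityI subsetI)
      fix x assume "x \<in> (\<Union>a. basic_ball \<alpha> (q p (pair i a)))"
      then obtain a where a: "x \<in> basic_ball \<alpha> (q p (pair i a))" by blast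
      have "basic_ball \<alpha> 0 = {}"
        by (simp add: basic_ball_eq prod_decode_0 rat_value_def)
      with a have "good (pfst (pfst a))" "valid i a" "x \<in> basic_ball \<alpha> (psnd a)"
        by (auto simp: q_def good_def split: if_splits)
      moreover from this(2) have "formally_inside (psnd a) (target i (pfst (pfst a)))"
        using B(2)[of "pair (psnd a) (target i (pfst (pfst a)))"] by (auto simp: valid_def)
      ultimately show "x \<in> (\<Union>c\<in>Collect good. cell (target i c))"
        using formally_inside_subset by blast
    next
      fix x assume "x \<in> (\<Union>c\<in>Collect good. cell (target i c))"
      then obtain c where c: "good c" "x \<in> cell (target i c)" by blast
      then obtain b where b: "formally_inside b (target i c)" "x \<in> basic_ball \<alpha> b"
        using cell_covered by blast
      then obtain u where "B (pair b (target i c)) u"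
        using B(2)[of "pair b (target i c)"] by auto
      then have "q p (pair i (pair (pair c u) b)) = b"
        using c(1) by (simp add: q_def good_def valid_def)
      with b(2) show "x \<in> (\<Union>a. basic_ball \<alpha> (q p (pair i a)))"
        by (metis UNIV_I UN_I)
    qed
    also have "\<dots> = U p i"
    proof (cases "psnd i = 0")
      case True
      then have good: "good (word_code w) \<longleftrightarrow> w \<in> E p (pfst i)" for w
        by (simp add: good_def E_def mem_psi_minus_words_iff component_def)
      have "(\<Union>c\<in>Collect good. cell (target i c)) = (\<Union>w\<in>E p (pfst i). cell (node w))"
      proof (intro equalityI subsetI)
        fix x assume "x \<in> (\<Union>c\<in>Collect good. cell (target i c))"
        then obtain c where c: "good c" "x \<in> cell (node_of c)"
          using True by (auto simp: target_def)
        obtain w where "c = word_code w"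
          using word_code_surj by metis
        then show "x \<in> (\<Union>w\<in>E p (pfst i). cell (node w))"
          using c good node_of by auto
      next
        fix x assume "x \<in> (\<Union>w\<in>E p (pfst i). cell (node w))"
        then obtain w where "w \<in> E p (pfst i)" "x \<in> cell (node w)" by blast
        then have "good (word_code w)" "x \<in> cell (target i (word_code w))"
          using True good by (simp_all add: target_def node_of)
        then show "x \<in> (\<Union>c\<in>Collect good. cell (target i c))" by blast
      qed
      then show ?thesis
        using True by (simp add: U_def)
    next
      case False
      have "cell (target i c) = (if c = 0 then {x. r (pfst i) < dist x (\<alpha> (pfst (pfst i)))}
          else {x. dist x (\<alpha> (pfst (pfst i))) < r (pfst i)})" for c
        using False by (simp add: cell_def target_def side_def Let_def)
      then have "(\<Union>c\<in>Collect good. cell (target i c)) =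
          {x. r (pfst i) < dist x (\<alpha> (pfst (pfst i)))} \<union> {x. dist x (\<alpha> (pfst (pfst i))) < r (pfst i)}"
        using False by (auto simp: good_def split: if_splits)
      then show ?thesis
        using False by (auto simp: U_def)
    qed
    finally show ?thesis .
  qed
  have "semidecidable (\<lambda>p z. \<exists>c. length (list_decode (node_of c)) = Suc (pfst z) \<and>
      psnd z = psnd (pfst (node_of c - 1)) \<and> named_inside p (node_of c))"
    by (intro semidecidable_intros semidecidable_named_inside rec_node_of recursive_intros
        decidable_imp_semidecidable[OF decidable_eq])
  then obtain \<Phi> where \<Phi>: "partial_recursive \<Phi>"
    "\<And>p n. \<exists>v c. length (list_decode (node_of c)) = Suc n \<and>
        v = psnd (pfst (node_of c - 1)) \<and> named_inside p (node_of c) \<Longrightarrow>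
      \<exists>v. \<Phi> p n = Some v \<and> (\<exists>c. length (list_decode (node_of c)) = Suc n \<and>
        v = psnd (pfst (node_of c - 1)) \<and> named_inside p (node_of c))"
    by (rule semidecidable_selection[where S = "\<lambda>p n v. \<exists>c. length (list_decode (node_of c)) = Suc n \<and>
      v = psnd (pfst (node_of c - 1)) \<and> named_inside p (node_of c)"]) blast
  have bit: "\<Phi> p n = Some (of_bool (last w))"
    if p: "cauchy_rep dist \<alpha> p = Some x" and w: "length w = Suc n" "x \<in> cell (node w)" for p x n w
  proof -
    have "\<exists>v c. length (list_decode (node_of c)) = Suc n \<and>
        v = psnd (pfst (node_of c - 1)) \<and> named_inside p (node_of c)"
      using w by (intro exI[of _ "psnd (pfst (node w - 1))"] exI[of _ "word_code w"])
        (simp add: node_of length_node named_inside_iff[OF p])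
    from \<Phi>(2)[OF this] obtain v c where c: "\<Phi> p n = Some v" "length (list_decode (node_of c)) = Suc n"
        "v = psnd (pfst (node_of c - 1))" "named_inside p (node_of c)"
      by blast
    obtain w' where "c = word_code w'"
      using word_code_surj by metis
    then have w': "length w' = Suc n" "v = psnd (pfst (node w' - 1))" "x \<in> cell (node w')"
      using c by (simp_all add: node_of length_node named_inside_iff[OF p])
    then have "w' = w"
      using node_unique w by simp
    moreover obtain u b where "w = u @ [b]"
      using w(1) by (cases w rule: rev_cases) auto
    ultimately show ?thesis
      using c(1) w'(2) by (simp add: node_snoc child_def)
  qed
  show ?thesis
  proof (rule sW_reducibleI[OF K \<Phi>(1)])
    fix p A
    assume "in_rep Pi01_G p = Some A" and "A \<in> mv_dom (multi Pi01_G)"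
    then have A: "A = (\<lambda>i. UNIV - (\<Union>w\<in>E p i. cylinder w))"
      and A': "\<forall>i. closed (A i) \<and> interior (A i) = {}"
      by (auto simp: Pi01_G_def seq_rep_psi_sharp mv_dom_pi01_generic E_def)
    define C where "C = (\<lambda>i. UNIV - U p i)"
    have "closed (C i)" for i
      using balls[of p i, symmetric] by (auto simp: C_def basic_ball_eq intro!: closed_Diff open_UN)
    moreover have "interior (C i) = {}" for i
    proof (cases "psnd i = 0")
      case True
      then show ?thesis
        using A' union_of_nodes_dense[of "E p (pfst i)"] by (simp add: A C_def U_def)
    next
      case False
      then have "C i = {x. dist x (\<alpha> (pfst (pfst i))) = r (pfst i)}"
        by (auto simp: C_def U_def)
      then show ?thesis
        using dist_neq_radius_dense by simp
    qed
    ultimately have C: "\<forall>i. closed (C i) \<and> interior (C i) = {}"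
      by blast
    have "in_rep (jump (BCT0 \<alpha>)) (K p) = Some C"
      by (simp add: jump_def BCT0_def map_comp_def lim seq_rep_psi_minus balls C_def)
    moreover have "C \<in> mv_dom (multi (jump (BCT0 \<alpha>)))"
      using C by (simp add: jump_def BCT0_def mv_dom_bct)
    moreover have "\<exists>s z. (\<forall>n. \<Phi> g n = Some (s n)) \<and> out_rep Pi01_G s = Some z \<and> z \<in> multi Pi01_G A"
      if g: "out_rep (jump (BCT0 \<alpha>)) g = Some x" and x: "x \<in> multi (jump (BCT0 \<alpha>)) C" for g x
    proof -
      have g: "cauchy_rep dist \<alpha> g = Some x"
        using g by (simp add: jump_def BCT0_def)
      have xU: "x \<in> U p i" for i
        using x C by (auto simp: jump_def BCT0_def bct_def C_def split: if_splits)
      have "dist x (\<alpha> (pfst k)) \<noteq> r k" for k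
        using xU[of "pair k 1"] by (simp add: U_def)
      then have "\<forall>t. \<exists>w. length w = t \<and> x \<in> cell (node w)"
        using ex_node by blast
      from choice[OF this] obtain W where W: "\<And>t. length (W t) = t" "\<And>t. x \<in> cell (node (W t))"
        by blast
      define y where "y n = last (W (Suc n))" for n
      have W_eq: "W t = map y [0..<t]" for t
      proof (induction t)
        case 0
        show ?case using W(1)[of 0] by simp
      next
        case (Suc t)
        have "W (Suc t) \<noteq> []"
          using W(1)[of "Suc t"] by auto
        then obtain u where u: "W (Suc t) = u @ [y t]"
          unfolding y_def by (metis append_butlast_last_id)
        then have "x \<in> cell (node u)"
          using W(2)[of "Suc t"] cell_node_append_subset[of u "[y t]"] by auto
        moreover have "length u = t"
          using W(1)[of "Suc t"] u by simp
        ultimately have "u = W t"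
          using node_unique[OF _ W(2)] W(1) by simp
        with u Suc show ?case by simp
      qed
      have "\<Phi> g n = Some (of_bool (y n))" for n
        using bit[OF g W(1,2)] by (simp add: y_def)
      moreover have "cantor_rep (\<lambda>n. of_bool (y n)) = Some y"
        by (auto simp: cantor_rep_def)
      moreover have "y \<notin> A i" for i
      proof -
        obtain w where w: "w \<in> E p i" "x \<in> cell (node w)"
          using xU[of "pair i 0"] by (auto simp: U_def)
        then have "w = map y [0..<length w]"
          using node_unique[OF w(2) W(2)[of "length w"]] W(1) W_eq by simp
        then have "y \<in> cylinder w"
          by (simp add: mem_cylinder_iff)
        with w(1) show ?thesis by (auto simp: A)
      qed
      ultimately show ?thesis
        using A' by (intro exI[of _ "\<lambda>n. of_bool (y n)"] exI[of _ y])
          (simp add: Pi01_G_def pi01_generic_def)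
    qed
    ultimately show "\<exists>u. in_rep (jump (BCT0 \<alpha>)) (K p) = Some u \<and> u \<in> mv_dom (multi (jump (BCT0 \<alpha>))) \<and>
        (\<forall>g x. out_rep (jump (BCT0 \<alpha>)) g = Some x \<and> x \<in> multi (jump (BCT0 \<alpha>)) u \<longrightarrow>
          (\<exists>s z. (\<forall>n. \<Phi> g n = Some (s n)) \<and> out_rep Pi01_G s = Some z \<and> z \<in> multi Pi01_G A))"
      by blast
  qed
qed

end

lemma (in effective_perfect_polish) Pi01_G_le_jump_BCT0: "Pi01_G \<le>\<^sub>s\<^sub>W jump (BCT0 \<alpha>)"
proof -
  obtain r where r: "computable_real (\<lambda>p. r)"
    "\<And>k. 0 < r k \<and> r k < 1 / 2 ^ psnd k \<and> (\<forall>m. dist (\<alpha> m) (\<alpha> (pfst k)) \<noteq> r k)"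
    using ex_generic_radii by blast
  interpret generic_radii \<alpha> r
    by unfold_locales (use r in auto)
  show ?thesis
    by (rule Pi01_G_le_jump_BCT0_with_radii)
qed

theorem corollary8p3:
  fixes \<alpha> :: "nat \<Rightarrow> 'a::{polish_space, perfect_space}"
  assumes "computable_polish \<alpha>"
  shows "Pi01_G \<equiv>\<^sub>s\<^sub>W BCT2 \<alpha> \<and> BCT2 \<alpha> \<equiv>\<^sub>s\<^sub>W jump (BCT0 \<alpha>)"
proof -
  interpret effective_perfect_polish \<alpha>
    by unfold_locales (rule assms)
  note reductions = Pi01_G_le_jump_BCT0 jump_BCT0_le_BCT2 BCT2_le_Pi01_G
  have "Pi01_G \<le>\<^sub>s\<^sub>W BCT2 \<alpha>" "BCT2 \<alpha> \<le>\<^sub>s\<^sub>W jump (BCT0 \<alpha>)"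
    by (rule sW_reducible_trans[OF reductions(1,2)], rule sW_reducible_trans[OF reductions(3,1)])
  with reductions show ?thesis
    by (simp add: sW_equivalent_def)
qed

end
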